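(* Let $V:\Omega\to\mathbb{R}$ be constant on each set $\{X_0=c\}$, $c\in S$, and let $\rho_V=(g_V)^{-1}\nu_V$ be the probability on $(\Omega,\mathcal{B})$ defined in the context. Then for every $t>0$ $$(\mathcal{L}_V^t)^*(\rho_V)=e^{t\lambda(V)}\rho_V ,$$ that is, $\int\mathcal{L}_V^t(f)\,d\rho_V=e^{t\lambda(V)}\int f\,d\rho_V$ for every $f\in\mathcal{L}^\infty(P)$.
   Context: Let $S=\{1,\dots,n\}$ and let $L$ be a real $n\times n$ matrix with $L_{ii}<0$ for all $i$, $L_{ij}\ge 0$ for $i\ne j$, and $\sum_{i=1}^n L_{ij}=0$ for every $j$. Put $P^t=e^{tL}$ (column stochastic), and let $p_0=(p_0^1,\dots,p_0^n)$ be a probability vector with $Lp_0=0$, hence $P^tp_0=p_0$ for all $t\ge 0$; all its entries are strictly positive. $\Omega$ is the set of right-continuous functions $w:[0,\infty)\to S$ (locally constant, with left and right limits), $\mathcal{B}$ is the $\sigma$-algebra generated by the cylinders in the coordinates $X_t(w)=w(t)$, and $\Theta_s:\Omega\to\Omega$ is $(\Theta_s w)(t)=w(t+s)$. $P$ is the stationary probability on $(\Omega,\mathcal{B})$ with $$P(X_0=a_0,X_{t_1}=a_1,\dots,X_{t_r}=a_r)=P^{t_r-t_{r-1}}_{a_r a_{r-1}}\cdots P^{t_2-t_1}_{a_2a_1}P^{t_1}_{a_1a_0}\,p_0^{a_0}\qquad(0<t_1<\dots<t_r).$$ For $t>0$ and $x\in\Omega$ let $\mu_t^x$ be the measure carried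 by $\Theta_t^{-1}(x)$ such that, for $0=t_0<t_1<\dots<t_{j-1}<t\le t_j<\dots<t_r$, $$\mu_t^x(X_0=a_0,\dots,X_{t_r}=a_r)=\frac{1}{p_0^{x(0)}}\,P^{t-t_{j-1}}_{x(0)\,a_{j-1}}\cdots P^{t_2-t_1}_{a_2a_1}P^{t_1}_{a_1a_0}\,p_0^{a_0}$$ if $a_k=x(t_k-t)$ for all $k\ge j$, and $0$ otherwise. The operator $\mathcal{L}^t:\mathcal{L}^\infty(P)\to\mathcal{L}^\infty(P)$ is $\mathcal{L}^t(\varphi)(x)=\int_{\Theta_t^{-1}(x)}\varphi\,d\mu_t^x$, and $\mathcal{L}_V^t:\mathcal{L}^\infty(P)\to\mathcal{L}^\infty(P)$ is $\mathcal{L}_V^t(f)=\mathcal{L}^t\big(e^{\int_0^t V\circ\Theta_s\,ds}f\big)$. Let $V_i$ be the value of $V$ on $\{X_0=i\}$; also write $V$ for the diagonal matrix with entries $V_i$. There exist a real number $\lambda(V)$, a unique strictly positive vector $u_V\in\mathbb{R}^n$ and a unique probability vector $\mu_V\in\mathbb{R}^n$ with strictly positive entries such that $\sum_i u_V^i(\mu_V)_i=1$, $u_V\,e^{s(L+V)}=e^{s\lambda(V)}u_V$ for all $s>0$ and $e^{t(L+V)}\mu_V=e^{t\lambda(V)}\mu_V$ for all $t>0$ (Perron–Frobenius). Write $\frac{\mu_V}{p_0}$ for the function $w\mapsto(\mu_V)_{w(0)}/p_0^{w(0)}$ on $\Omega$ and $\frac{p_0}{\mu_V}$ for its reciprocal,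 and put $$\hat{\mathcal{L}}_V^t(g)=\frac{p_0}{\mu_V}\,\mathcal{L}^t\Big(e^{\int_0^t (V-\lambda(V))\circ\Theta_s\,ds}\,g\,\frac{\mu_V}{p_0}\Big).$$ With $\lambda=\lambda(V)$ and $I$ the identity matrix, $\nu_V$ is the probability on $(\Omega,\mathcal{B})$ given on cylinders, for $0<t_1<\dots<t_r$, by $$\nu_V(X_0=a_0,X_{t_1}=a_1,\dots,X_{t_r}=a_r)=\big(e^{(t_r-t_{r-1})(L+V-\lambda I)}\big)_{a_ra_{r-1}}\cdots\big(e^{(t_2-t_1)(L+V-\lambda I)}\big)_{a_2a_1}\big(e^{t_1(L+V-\lambda I)}\big)_{a_1a_0}\,\mu_V(a_0).$$ It does not depend on $t$ and is fixed by the dual operators: $(\hat{\mathcal{L}}_V^t)^*(\nu_V)=\nu_V$ for every $t>0$. Finally $g_V$ is the multiple of $\frac{\mu_V}{p_0}$ for which $\rho_V=(g_V)^{-1}\nu_V$ (density $1/g_V$ with respect to $\nu_V$) is a probability, not necessarily $\Theta_s$-invariant; $\rho_V$ is absolutely continuous with respect to $P$.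
   Formalization: As printed, ν_V exists only for constant V; the formal theorem proves that case and, for general V, the identity with the cylinder values of ν_V multiplied by u_V^{a_r}, for f in L^∞(P) also essentially bounded for ρ_V (which need not be absolutely continuous w.r.t. P). *)

theory Defs
  imports "HOL-Probability.Probability"
begin

(* On real^'n^'n the operations "*", "^" and "1" of the library are componentwise, so powers
   are taken with respect to the matrix product "**". *)
definition matrix_exp :: "real^'n^'n \<Rightarrow> real^'n^'n" where
  "matrix_exp A = (\<Sum>k. (1 / fact k) *\<^sub>R ((\<lambda>B. A ** B) ^^ k) (mat 1))"

definition diag_matrix :: "real^'n \<Rightarrow> real^'n^'n" where
  "diag_matrix v = (\<chi> i j. if i = j then v $ i else 0)"

definition is_generator :: "real^'n^'n \<Rightarrow> bool" where
  "is_generator L \<longleftrightarrow>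
     (\<forall>i. L $ i $ i < 0) \<and> (\<forall>i j. i \<noteq> j \<longrightarrow> 0 \<le> L $ i $ j) \<and> (\<forall>j. (\<Sum>i\<in>UNIV. L $ i $ j) = 0)"

definition positive_probability_vector :: "real^'n \<Rightarrow> bool" where
  "positive_probability_vector q \<longleftrightarrow> (\<forall>i. 0 < q $ i) \<and> (\<Sum>i\<in>UNIV. q $ i) = 1"

definition semigroup_P :: "real^'n^'n \<Rightarrow> real \<Rightarrow> real^'n^'n" where
  "semigroup_P L t = matrix_exp (t *\<^sub>R L)"

(* A path is a function on [0,\<infinity>); as a HOL function on all reals it is pinned to the
   value undefined at negative times, so that equality of paths is equality on [0,\<infinity>).
   The state space is discrete, hence limits are eventual equalities. *)
type_synonym 'n path = "real \<Rightarrow> 'n"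

definition paths :: "'n path set" where
  "paths = {w \<in> extensional {0..}.
     (\<forall>t\<ge>0. \<forall>\<^sub>F s in at_right t. w s = w t) \<and>
     (\<forall>t>0. \<exists>a. \<forall>\<^sub>F s in at_left t. w s = a)}"

definition path_algebra :: "'n path measure" where
  "path_algebra = sigma paths {{w \<in> paths. w t = a} | t a. 0 \<le> t}"

definition path_shift :: "real \<Rightarrow> 'n path \<Rightarrow> 'n path" where
  "path_shift s w = (\<lambda>t\<in>{0..}. w (t + s))"

definition time_grid :: "nat \<Rightarrow> (nat \<Rightarrow> real) \<Rightarrow> bool" where
  "time_grid r ts \<longleftrightarrow> ts 0 = 0 \<and> (\<forall>k<r. ts k < ts (Suc k))"

definition cylinder :: "nat \<Rightarrow> (nat \<Rightarrow> real) \<Rightarrow> (nat \<Rightarrow> 'n) \<Rightarrow> 'n path set" where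
  "cylinder r ts a = {w \<in> paths. \<forall>k\<le>r. w (ts k) = a k}"

definition chain_weight ::
    "(real \<Rightarrow> real^'n^'n) \<Rightarrow> real^'n \<Rightarrow> nat \<Rightarrow> (nat \<Rightarrow> real) \<Rightarrow> (nat \<Rightarrow> 'n) \<Rightarrow> real" where
  "chain_weight K q r ts a = (\<Prod>k<r. K (ts (Suc k) - ts k) $ a (Suc k) $ a k) * q $ a 0"

definition is_stationary_P :: "real^'n^'n \<Rightarrow> real^'n \<Rightarrow> 'n path measure \<Rightarrow> bool" where
  "is_stationary_P L p0 M \<longleftrightarrow> prob_space M \<and> sets M = sets path_algebra \<and>
     (\<forall>r ts a. time_grid r ts \<longrightarrow>
        measure M (cylinder r ts a) = chain_weight (semigroup_P L) p0 r ts a)"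

definition is_fiber_measure ::
    "real^'n^'n \<Rightarrow> real^'n \<Rightarrow> real \<Rightarrow> 'n path \<Rightarrow> 'n path measure \<Rightarrow> bool" where
  "is_fiber_measure L p0 t x M \<longleftrightarrow> sets M = sets path_algebra \<and> (AE w in M. path_shift t w = x) \<and>
     (\<forall>r j ts a. time_grid r ts \<and> 1 \<le> j \<and> j \<le> r \<and> ts (j - 1) < t \<and> t \<le> ts j \<longrightarrow>
        emeasure M (cylinder r ts a) =
          (if \<forall>k\<in>{j..r}. a k = x (ts k - t)
           then ennreal (1 / p0 $ x 0 * semigroup_P L (t - ts (j - 1)) $ x 0 $ a (j - 1)
                         * chain_weight (semigroup_P L) p0 (j - 1) ts a)
           else 0))"

definition fiber_measure ::
    "real^'n^'n \<Rightarrow> real^'n \<Rightarrow> real \<Rightarrow> 'n path \<Rightarrow> 'n path measure" where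
  "fiber_measure L p0 t x = (THE M. is_fiber_measure L p0 t x M)"

(* Representatives of the classes in L-infinity of M. *)
definition Linf :: "'a measure \<Rightarrow> ('a \<Rightarrow> real) set" where
  "Linf M = {f \<in> borel_measurable M. \<exists>C. AE w in M. \<bar>f w\<bar> \<le> C}"

definition ruelle ::
    "real^'n^'n \<Rightarrow> real^'n \<Rightarrow> real \<Rightarrow> ('n path \<Rightarrow> real) \<Rightarrow> 'n path \<Rightarrow> real" where
  "ruelle L p0 t \<phi> x = (LINT w:{w \<in> paths. path_shift t w = x}|fiber_measure L p0 t x. \<phi> w)"

definition ruelle_V ::
    "real^'n^'n \<Rightarrow> real^'n \<Rightarrow> ('n path \<Rightarrow> real) \<Rightarrow> real \<Rightarrow> ('n path \<Rightarrow> real) \<Rightarrow> 'n path \<Rightarrow> real" where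
  "ruelle_V L p0 V t f =
     ruelle L p0 t (\<lambda>w. exp (integral {0..t} (\<lambda>s. V (path_shift s w))) * f w)"

definition is_perron_data ::
    "real^'n^'n \<Rightarrow> real^'n \<Rightarrow> real \<Rightarrow> real^'n \<Rightarrow> real^'n \<Rightarrow> bool" where
  "is_perron_data L v lam u \<mu> \<longleftrightarrow>
     (\<forall>i. 0 < u $ i) \<and> positive_probability_vector \<mu> \<and> (\<Sum>i\<in>UNIV. u $ i * \<mu> $ i) = 1 \<and>
     (\<forall>s>0. u v* matrix_exp (s *\<^sub>R (L + diag_matrix v)) = exp (s * lam) *\<^sub>R u) \<and>
     (\<forall>t>0. matrix_exp (t *\<^sub>R (L + diag_matrix v)) *v \<mu> = exp (t * lam) *\<^sub>R \<mu>)"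

definition semigroup_V :: "real^'n^'n \<Rightarrow> real^'n \<Rightarrow> real \<Rightarrow> real \<Rightarrow> real^'n^'n" where
  "semigroup_V L v lam s = matrix_exp (s *\<^sub>R (L + diag_matrix v - lam *\<^sub>R mat 1))"

definition is_nu_V ::
    "real^'n^'n \<Rightarrow> real^'n \<Rightarrow> real \<Rightarrow> real^'n \<Rightarrow> 'n path measure \<Rightarrow> bool" where
  "is_nu_V L v lam \<mu> M \<longleftrightarrow> prob_space M \<and> sets M = sets path_algebra \<and>
     (\<forall>r ts a. time_grid r ts \<longrightarrow>
        measure M (cylinder r ts a) = chain_weight (semigroup_V L v lam) \<mu> r ts a)"

(* The cylinder values of is_nu_V are consistent under summation over the last state only if
   the columns of L + V all sum to lam, which forces V to be constant. The left eigenvector u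
   as terminal weight makes them consistent for every V; u = (1,...,1) gives back is_nu_V. *)
definition is_weighted_nu_V ::
    "real^'n^'n \<Rightarrow> real^'n \<Rightarrow> real \<Rightarrow> real^'n \<Rightarrow> real^'n \<Rightarrow> 'n path measure \<Rightarrow> bool" where
  "is_weighted_nu_V L v lam u \<mu> M \<longleftrightarrow> prob_space M \<and> sets M = sets path_algebra \<and>
     (\<forall>r ts a. time_grid r ts \<longrightarrow>
        measure M (cylinder r ts a) = u $ a r * chain_weight (semigroup_V L v lam) \<mu> r ts a)"

definition g_V :: "real^'n \<Rightarrow> real^'n \<Rightarrow> real \<Rightarrow> 'n path \<Rightarrow> real" where
  "g_V p0 \<mu> c w = c * (\<mu> $ w 0 / p0 $ w 0)"

definition rho_V :: "real^'n \<Rightarrow> real^'n \<Rightarrow> real \<Rightarrow> 'n path measure \<Rightarrow> 'n path measure" where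
  "rho_V p0 \<mu> c \<nu> = density \<nu> (\<lambda>w. ennreal (1 / g_V p0 \<mu> c w))"

end

(* Given the present state x(0), the fibre measure over x is the law under P of the past conditioned
   on X_t = x(0), glued to x. The weight exp (int_0^t V) turns the generator L of that past into
   L + V (Feynman-Kac, obtained here from Riemann sums of V along a refined time grid and the
   Lie-Trotter formula). Since rho_V has the cylinder values of the chain with semigroup
   e^(s(L + V - lambda)) started in p_0, with some terminal weight, averaging the weighted fibre
   measures over rho_V reproduces rho_V up to the factor e^(t lambda) that compensates lambda. *)
theory Submission
  imports Defs
begin

section \<open>Bounded operators as a Banach algebra\<close>

text \<open>\<open>fiber_measure\<close> is a definite description, so nothing can be said about it
  before a measure with the prescribed cylinder values has been built and shown to be unique;
  \<open>bridge\<close> supplies it. The values are prescribed only on time grids that start at 0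
  and reach \<open>t\<close>, hence uniqueness is argued with cylinders whose times contain 0 and
  \<open>t\<close>. The terminal weight depends only on the last state of a cylinder, and shifting
  the cylinder by \<open>t\<close> keeps that state. One computation with an arbitrary weight
  \<open>z\<close> therefore serves both readings of \<nu>: weight 1, where the cylinder values
  force V to be constant and \<rho> to be a multiple of P, and weight \<open>u\<close>. An identity
  of measures does not yet settle functions that are bounded only almost everywhere: a \<rho>-null
  set has to be null for almost every fibre measure as well. This is read off from the same
  identity, applied to the indicator of the null set; strict positivity of the exponential weight
  makes it work.\<close>

typedef (overloaded) ('a::real_normed_vector) endo = "UNIV :: ('a \<Rightarrow>\<^sub>L 'a) set"
  morphisms blinfun_of_endo Endo ..

setup_lifting type_definition_endo

text \<open>\<open>perfect_space\<close> excludes the zero space, so that the identity has norm 1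
  and differs from 0. With composition as product, the type-class exponential and its derivative
  rules become available for operators, hence for matrices.\<close>

instantiation endo :: ("{banach, perfect_space}") real_normed_algebra_1
begin

lift_definition zero_endo :: "'a endo" is 0 .
lift_definition one_endo :: "'a endo" is id_blinfun .
lift_definition plus_endo :: "'a endo \<Rightarrow> 'a endo \<Rightarrow> 'a endo" is "(+)" .
lift_definition minus_endo :: "'a endo \<Rightarrow> 'a endo \<Rightarrow> 'a endo" is "(-)" .
lift_definition uminus_endo :: "'a endo \<Rightarrow> 'a endo" is uminus .
lift_definition times_endo :: "'a endo \<Rightarrow> 'a endo \<Rightarrow> 'a endo" is "(o\<^sub>L)" .
lift_definition scaleR_endo :: "real \<Rightarrow> 'a endo \<Rightarrow> 'a endo" is scaleR .
lift_definition norm_endo :: "'a endo \<Rightarrow> real" is norm .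

definition dist_endo :: "'a endo \<Rightarrow> 'a endo \<Rightarrow> real" where "dist_endo S T = norm (S - T)"
lift_definition sgn_endo :: "'a endo \<Rightarrow> 'a endo" is "\<lambda>T. T /\<^sub>R norm T" .
definition [code del]: "(uniformity :: ('a endo \<times> 'a endo) filter) =
  (INF e\<in>{0 <..}. principal {(x, y). dist x y < e})"
definition [code del]: "open (U :: 'a endo set) \<longleftrightarrow>
  (\<forall>x\<in>U. \<forall>\<^sub>F (x', y) in uniformity. x' = x \<longrightarrow> y \<in> U)"

instance
proof
  fix S T U :: "'a endo" and a b :: real
  show "dist S T = norm (S - T)" by (rule dist_endo_def)
  show "sgn T = inverse (norm T) *\<^sub>R T" by transfer simp
  show "(uniformity :: ('a endo \<times> 'a endo) filter) = (INF e\<in>{0 <..}. principal {(x, y). dist x y < e})"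
    by (rule uniformity_endo_def)
  show "open W \<longleftrightarrow> (\<forall>x\<in>W. \<forall>\<^sub>F (x', y) in uniformity. x' = x \<longrightarrow> y \<in> W)" for W :: "'a endo set"
    by (rule open_endo_def)
  show "S + T + U = S + (T + U)" "S + T = T + S" "0 + T = T" "- T + T = 0" "S - T = S + - T"
    by (transfer, simp)+
  show "a *\<^sub>R (S + T) = a *\<^sub>R S + a *\<^sub>R T" "(a + b) *\<^sub>R T = a *\<^sub>R T + b *\<^sub>R T"
    "a *\<^sub>R b *\<^sub>R T = (a * b) *\<^sub>R T" "1 *\<^sub>R T = T"
    by (transfer, simp add: algebra_simps)+
  show "S * T * U = S * (T * U)" "1 * T = T" "T * 1 = T" "(S + T) * U = S * U + T * U"
    "S * (T + U) = S * T + S * U" "a *\<^sub>R S * T = a *\<^sub>R (S * T)" "S * a *\<^sub>R T = a *\<^sub>R (S * T)"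
    by (transfer, rule blinfun_eqI, simp add: blinfun.bilinear_simps)+
  have "norm (0 :: 'a endo) = 0" "norm (1 :: 'a endo) = 1" by (transfer, simp)+
  then show "(0 :: 'a endo) \<noteq> 1" "norm (1 :: 'a endo) = 1" by auto
  show "(norm T = 0) = (T = 0)" "norm (S + T) \<le> norm S + norm T" "norm (a *\<^sub>R T) = \<bar>a\<bar> * norm T"
    by (transfer, simp add: norm_triangle_ineq)+
  show "norm (S * T) \<le> norm S * norm T" by transfer (rule norm_blinfun_compose)
qed

end

instance endo :: ("{banach, perfect_space}") banach
proof
  fix X :: "nat \<Rightarrow> 'a endo" assume "Cauchy X"
  have dist: "dist (blinfun_of_endo S) (blinfun_of_endo T) = dist S T" for S T :: "'a endo"
    unfolding dist_norm by transfer simp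
  have "Cauchy (\<lambda>k. blinfun_of_endo (X k))"
    using \<open>Cauchy X\<close> by (simp add: Cauchy_def dist)
  then obtain B where "(\<lambda>k. blinfun_of_endo (X k)) \<longlonglongrightarrow> B"
    using Cauchy_convergent convergent_def by blast
  then have "(\<lambda>k. blinfun_of_endo (X k)) \<longlonglongrightarrow> blinfun_of_endo (Endo B)"
    by (simp add: Endo_inverse)
  then have "X \<longlonglongrightarrow> Endo B"
    by (simp add: lim_sequentially dist)
  then show "convergent X" by (rule convergentI)
qed

section \<open>The Lie-Trotter product formula in a Banach algebra\<close>

lemma norm_power_diff_le:
  fixes x y :: "'a::real_normed_algebra_1"
  assumes "norm x \<le> c" "norm y \<le> c" "1 \<le> c"
  shows "norm (x ^ n - y ^ n) \<le> n * c ^ n * norm (x - y)"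
proof (induction n)
  case (Suc n)
  have "norm (y ^ n) \<le> c ^ n"
    using norm_power_ineq[of y n] power_mono[OF assms(2), of n] by simp
  also have "\<dots> \<le> c ^ Suc n" using assms(3) by simp
  finally have y: "norm ((x - y) * y ^ n) \<le> c ^ Suc n * norm (x - y)"
    using norm_mult_ineq[of "x - y" "y ^ n"]
    by (smt (verit) mult.commute mult_left_mono norm_ge_zero)
  have "norm (x * (x ^ n - y ^ n)) \<le> c * (n * c ^ n * norm (x - y))"
    using norm_mult_ineq[of x "x ^ n - y ^ n"] mult_mono[OF assms(1) Suc.IH] assms(3) by force
  \<comment> \<open>Iterated, this recursion is the telescoping sum of the terms
    \<open>x^k * (x - y) * y^(n-1-k)\<close> for \<open>k < n\<close>. The exponent \<open>n\<close>
    in place of \<open>n - 1\<close> in the bound costs only a factor \<open>c\<close>, which is at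
    least 1.\<close>
  moreover have "x ^ Suc n - y ^ Suc n = x * (x ^ n - y ^ n) + (x - y) * y ^ n"
    by (simp add: algebra_simps)
  ultimately show ?case
    using norm_triangle_ineq[of "x * (x ^ n - y ^ n)" "(x - y) * y ^ n"] y
    by (simp add: algebra_simps)
qed simp

lemma exp_scaleR_has_vector_derivative_0 [derivative_intros]:
  fixes A :: "'a::{real_normed_algebra_1, banach}"
  shows "((\<lambda>h. exp (h *\<^sub>R A)) has_vector_derivative A) (at 0 within S)"
  using exp_scaleR_has_vector_derivative_right[of A 0 S] by simp

lemma exp_of_nat_scaleR:
  "exp (real n *\<^sub>R x) = exp x ^ n" for x :: "'a::{real_normed_algebra_1, banach}"
proof (induction n)
  case (Suc n)
  have "exp (x + real n *\<^sub>R x) = exp x * exp (real n *\<^sub>R x)"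
    by (rule exp_add_commuting) simp
  with Suc show ?case by (simp add: algebra_simps)
qed simp

lemma exp_scaleR_inverse_power:
  "exp ((1 / real (Suc n)) *\<^sub>R x) ^ Suc n = exp x" for x :: "'a::{real_normed_algebra_1, banach}"
  by (subst exp_of_nat_scaleR[symmetric]) simp

text \<open>The curves \<open>exp (h B) * exp (h A)\<close> and \<open>exp (h (A + B))\<close> both
  start at 1 with derivative \<open>A + B\<close>, so at \<open>h = 1/n\<close> they differ by
  o(1/n). Passing to n-th powers multiplies the difference by at most n times a constant, which
  leaves o(1).\<close>

theorem Lie_Trotter:
  fixes A B :: "'a::{real_normed_algebra_1, banach}"
  shows "(\<lambda>n. (exp ((1 / Suc n) *\<^sub>R B) * exp ((1 / Suc n) *\<^sub>R A)) ^ Suc n) \<longlonglongrightarrow> exp (A + B)"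
proof -
  define x where "x h = exp (h *\<^sub>R B) * exp (h *\<^sub>R A)" for h
  define y where "y h = exp (h *\<^sub>R (A + B))" for h
  \<comment> \<open>Both curves are bounded by \<open>exp (h * C)\<close>, whose power at
    \<open>h = 1 / Suc n\<close> is \<open>exp C\<close> for every n; this is the constant that the
    power estimate contributes.\<close>
  define C where "C = norm A + norm B"
  have "((\<lambda>h. x h - y h) has_vector_derivative 0) (at 0)"
    unfolding x_def y_def
    by (rule derivative_eq_intros exp_scaleR_has_vector_derivative_0 refl | simp)+
  then have "((\<lambda>h. inverse \<bar>h\<bar> * norm (x h - y h)) \<longlongrightarrow> 0) (at 0)"
    by (simp add: has_vector_derivative_def has_derivative_at x_def y_def divide_inverse mult.commute)
  then have "(\<lambda>n. inverse \<bar>1 / Suc n\<bar> * norm (x (1 / Suc n) - y (1 / Suc n))) \<longlonglongrightarrow> 0"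
    by (rule filterlim_compose)
       (use LIMSEQ_Suc[OF lim_1_over_n] in \<open>auto simp: filterlim_at intro!: always_eventually\<close>)
  then have lim: "(\<lambda>n. exp C * (Suc n * norm (x (1 / Suc n) - y (1 / Suc n)))) \<longlonglongrightarrow> 0"
    by (intro tendsto_mult_right_zero) (simp add: mult.commute del: of_nat_Suc)
  have "(\<lambda>n. x (1 / Suc n) ^ Suc n - y (1 / Suc n) ^ Suc n) \<longlonglongrightarrow> 0"
  proof (rule Lim_null_comparison[OF always_eventually lim], rule allI)
    fix n
    define h where "h = 1 / real (Suc n)"
    have h: "0 \<le> h" by (simp add: h_def)
    have "norm (x h) \<le> exp (norm (h *\<^sub>R B)) * exp (norm (h *\<^sub>R A))"
      unfolding x_def by (rule order_trans[OF norm_mult_ineq mult_mono]) (simp_all add: norm_exp del: norm_scaleR)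
    also have "\<dots> = exp (h * C)" using h by (simp add: C_def exp_add[symmetric] algebra_simps)
    finally have x: "norm (x h) \<le> exp (h * C)" .
    have "norm (y h) \<le> exp (norm (h *\<^sub>R (A + B)))"
      unfolding y_def by (rule norm_exp)
    also have "\<dots> \<le> exp (h * C)"
      using h norm_triangle_ineq[of A B] by (simp add: C_def mult_left_mono)
    finally have y: "norm (y h) \<le> exp (h * C)" .
    have "exp (h * C) ^ Suc n = exp C"
      by (simp add: exp_of_nat_mult[symmetric] h_def del: power_Suc of_nat_Suc)
    moreover have "1 \<le> exp (h * C)" using h by (simp add: C_def)
    ultimately show "norm (x (1 / Suc n) ^ Suc n - y (1 / Suc n) ^ Suc n)
        \<le> exp C * (Suc n * norm (x (1 / Suc n) - y (1 / Suc n)))"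
      using norm_power_diff_le[OF x y, of "Suc n"] unfolding h_def by (simp add: mult_ac del: power_Suc)
  qed
  moreover have "y (1 / Suc n) ^ Suc n = exp (A + B)" for n
    unfolding y_def by (rule exp_scaleR_inverse_power)
  ultimately have "(\<lambda>n. x (1 / Suc n) ^ Suc n - exp (A + B)) \<longlonglongrightarrow> 0"
    by (simp only:)
  then show ?thesis
    unfolding x_def by (rule LIM_zero_cancel)
qed

section \<open>The matrix exponential\<close>

text \<open>One half of a linear bijection that turns \<open>**\<close> into composition of
  operators; through it the exponential of a matrix becomes the exponential of a Banach
  algebra.\<close>

definition endo_of_matrix :: "real^'n^'n \<Rightarrow> (real^'n) endo" where
  "endo_of_matrix A = Endo (Blinfun ((*v) A))"

definition matrix_of_endo :: "(real^'n) endo \<Rightarrow> real^'n^'n" where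
  "matrix_of_endo T = matrix (blinfun_apply (blinfun_of_endo T))"

lemma blinfun_of_endo_of_matrix: "blinfun_apply (blinfun_of_endo (endo_of_matrix A)) x = A *v x"
  by (simp add: endo_of_matrix_def Endo_inverse bounded_linear_Blinfun_apply
      matrix_vector_mul_bounded_linear)

lemma matrix_of_endo_mult_vec: "matrix_of_endo T *v x = blinfun_apply (blinfun_of_endo T) x"
  unfolding matrix_of_endo_def
  by (rule matrix_works)
     (simp add: linear_matrix_vector_mul_eq blinfun.bounded_linear_right bounded_linear.linear)

lemma endo_eqI: "S = T" if "\<And>x. blinfun_apply (blinfun_of_endo S) x = blinfun_apply (blinfun_of_endo T) x"
  using that by (metis blinfun_eqI blinfun_of_endo_inject)

lemma endo_of_matrix_inverse [simp]: "matrix_of_endo (endo_of_matrix A) = A"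
  by (simp add: matrix_eq matrix_of_endo_mult_vec blinfun_of_endo_of_matrix)

lemma matrix_of_endo_inverse [simp]: "endo_of_matrix (matrix_of_endo T) = T"
  by (rule endo_eqI) (simp add: blinfun_of_endo_of_matrix matrix_of_endo_mult_vec)

lemma matrix_of_endo_1: "matrix_of_endo 1 = mat 1"
  by (simp add: matrix_eq matrix_of_endo_mult_vec one_endo.rep_eq)

lemma matrix_of_endo_mult: "matrix_of_endo (S * T) = matrix_of_endo S ** matrix_of_endo T"
  by (simp add: matrix_eq matrix_of_endo_mult_vec times_endo.rep_eq flip: matrix_vector_mul_assoc)

lemma matrix_of_endo_nth: "matrix_of_endo T $ i $ j = blinfun_apply (blinfun_of_endo T) (axis j 1) $ i"
  by (simp add: matrix_of_endo_def matrix_def)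

lemma bounded_linear_blinfun_of_endo:
  "bounded_linear (blinfun_of_endo :: 'a::{banach, perfect_space} endo \<Rightarrow> _)"
  by standard (auto simp: plus_endo.rep_eq scaleR_endo.rep_eq norm_endo.rep_eq intro!: exI[of _ 1])

lemma bounded_linear_matrix_of_endo_nth: "bounded_linear (\<lambda>T. matrix_of_endo T $ i $ j)"
  unfolding matrix_of_endo_nth
  by (intro bounded_linear_compose[OF bounded_linear_vec_nth]
      bounded_linear_compose[OF blinfun.bounded_linear_left] bounded_linear_blinfun_of_endo)

lemma tendsto_matrix_of_endo:
  "(f \<longlongrightarrow> T) F \<Longrightarrow> ((\<lambda>x. matrix_of_endo (f x)) \<longlongrightarrow> matrix_of_endo T) F"
  by (intro vec_tendstoI bounded_linear.tendsto[OF bounded_linear_matrix_of_endo_nth])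

lemma matrix_of_endo_linear: "linear matrix_of_endo"
  by (rule linearI)
     (simp_all add: vec_eq_iff matrix_of_endo_nth plus_endo.rep_eq scaleR_endo.rep_eq
      blinfun.bilinear_simps)

lemma endo_of_matrix_linear: "linear endo_of_matrix"
  by (rule linearI; rule endo_eqI)
     (simp_all add: blinfun_of_endo_of_matrix plus_endo.rep_eq scaleR_endo.rep_eq
      blinfun.bilinear_simps matrix_vector_mult_add_rdistrib scaleR_matrix_vector_assoc)

lemma matrix_of_endo_power: "matrix_of_endo (T ^ k) = ((\<lambda>B. matrix_of_endo T ** B) ^^ k) (mat 1)"
  by (induction k) (simp_all add: matrix_of_endo_1 matrix_of_endo_mult)

text \<open>The exponential series converges in the operator algebra, and
  \<open>matrix_of_endo\<close> is linear and continuous. Convergence has to be part of the claim,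
  because the infinite sum in \<open>matrix_exp\<close> carries information only for summable
  terms.\<close>

lemma matrix_exp_sums:
  "(\<lambda>k. (1 / fact k) *\<^sub>R ((\<lambda>B. A ** B) ^^ k) (mat 1)) sums matrix_of_endo (exp (endo_of_matrix A))"
proof -
  have "(\<lambda>k. endo_of_matrix A ^ k /\<^sub>R fact k) sums exp (endo_of_matrix A)"
    by (rule exp_converges)
  then have "(\<lambda>m. matrix_of_endo (\<Sum>k<m. endo_of_matrix A ^ k /\<^sub>R fact k))
      \<longlonglongrightarrow> matrix_of_endo (exp (endo_of_matrix A))"
    unfolding sums_def by (rule tendsto_matrix_of_endo)
  then show ?thesis
    by (simp add: sums_def linear_sum[OF matrix_of_endo_linear] linear_cmul[OF matrix_of_endo_linear]
        matrix_of_endo_power divide_inverse)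
qed

lemma matrix_exp_eq: "matrix_exp A = matrix_of_endo (exp (endo_of_matrix A))"
  unfolding matrix_exp_def by (rule sums_unique[OF matrix_exp_sums, symmetric])

lemma endo_of_matrix_mat_1: "endo_of_matrix (mat 1) = 1"
  by (metis matrix_of_endo_1 matrix_of_endo_inverse)

lemma exp_scaleR_one:
  "exp (c *\<^sub>R 1) = exp c *\<^sub>R (1 :: 'a::{real_normed_algebra_1, banach})"
proof -
  have "(\<lambda>k. (c ^ k /\<^sub>R fact k) *\<^sub>R (1 :: 'a)) sums (exp c *\<^sub>R 1)"
    by (rule bounded_linear.sums[OF bounded_linear_scaleR_left exp_converges])
  moreover have "(c *\<^sub>R 1 :: 'a) ^ k = c ^ k *\<^sub>R 1" for k
    by (metis of_real_def of_real_power)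
  ultimately show ?thesis
    using exp_converges[of "c *\<^sub>R 1 :: 'a"] by (simp add: sums_unique2)
qed

text \<open>A multiple of the identity commutes with every operator and splits off as a scalar
  factor. This converts between \<open>semigroup_V\<close> and the exponential of
  \<open>s (L + V)\<close>.\<close>

lemma matrix_exp_diff_scalar: "matrix_exp (A - c *\<^sub>R mat 1) = exp (- c) *\<^sub>R matrix_exp A"
proof -
  have "endo_of_matrix (A - c *\<^sub>R mat 1) = endo_of_matrix A + (- c) *\<^sub>R 1"
    by (simp add: linear_diff[OF endo_of_matrix_linear] linear_cmul[OF endo_of_matrix_linear]
        endo_of_matrix_mat_1)
  moreover have "exp (endo_of_matrix A + (- c) *\<^sub>R 1) = exp (- c) *\<^sub>R exp (endo_of_matrix A)"
    by (subst exp_add_commuting, simp, subst exp_scaleR_one) simp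
  ultimately show ?thesis
    by (simp add: matrix_exp_eq linear_cmul[OF matrix_of_endo_linear])
qed

lemma matrix_exp_diag: "matrix_exp (diag_matrix d) = diag_matrix (\<chi> i. exp (d $ i))"
proof -
  have "((\<lambda>B. diag_matrix d ** B) ^^ k) (mat 1) = diag_matrix (\<chi> i. d $ i ^ k)" for k
    by (induction k)
       (auto simp: diag_matrix_def mat_def vec_eq_iff matrix_matrix_mult_def if_distrib[of "\<lambda>x. x * _"]
        cong: if_cong)
  then have *: "(\<lambda>k. (1 / fact k) *\<^sub>R diag_matrix (\<chi> i. d $ i ^ k)) sums matrix_exp (diag_matrix d)"
    using matrix_exp_sums[of "diag_matrix d"] by (simp add: matrix_exp_eq)
  have "matrix_exp (diag_matrix d) $ i $ j = diag_matrix (\<chi> i. exp (d $ i)) $ i $ j" for i j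
  proof -
    have "(\<lambda>k. (1 / fact k) * (if i = j then d $ i ^ k else 0)) sums (matrix_exp (diag_matrix d) $ i $ j)"
      using bounded_linear.sums[OF bounded_linear_compose[OF bounded_linear_vec_nth bounded_linear_vec_nth] *,
          of i j]
      by (simp add: diag_matrix_def[of "\<chi> i. _ i"] if_distrib[of "\<lambda>x. _ * x"] cong: if_cong)
    moreover have "(\<lambda>k. (1 / fact k) * (if i = j then d $ i ^ k else 0)) sums (if i = j then exp (d $ i) else 0)"
      using exp_converges[of "d $ i"] by (cases "i = j") (simp_all add: divide_inverse mult.commute)
    ultimately show ?thesis
      by (auto simp: diag_matrix_def dest: sums_unique2)
  qed
  then show ?thesis by (simp add: vec_eq_iff)
qed

text \<open>Every term of the exponential series except the one for \<open>k = 0\<close> annihilates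
  x. With \<open>A = t L\<close> and \<open>x = p0\<close> this is the stationarity of
  \<open>p0\<close>.\<close>

lemma matrix_exp_fixes_kernel:
  assumes "A *v x = 0"
  shows "matrix_exp A *v x = x"
proof -
  have "((\<lambda>B. A ** B) ^^ k) (mat 1) *v x = (if k = 0 then x else 0)" for k
  proof (induction k)
    case (Suc k)
    then show ?case
      using assms by (auto simp: matrix_vector_mult_0_right simp flip: matrix_vector_mul_assoc)
  qed simp
  moreover have "bounded_linear (\<lambda>B :: real^'a^'a. B *v x)"
    by (intro linear_conv_bounded_linear[THEN iffD1] linearI)
       (simp_all add: matrix_vector_mult_add_rdistrib scaleR_matrix_vector_assoc)
  from bounded_linear.sums[OF this matrix_exp_sums[of A]]
  have "(\<lambda>k. (1 / fact k) *\<^sub>R (((\<lambda>B. A ** B) ^^ k) (mat 1) *v x)) sums (matrix_exp A *v x)"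
    by (simp add: matrix_exp_eq scaleR_matrix_vector_assoc)
  moreover have "(1 / fact k) *\<^sub>R (if k = 0 then x else 0) = (if k = 0 then x else 0)" for k
    by simp
  ultimately have "(\<lambda>k. if k = 0 then x else 0) sums (matrix_exp A *v x)"
    by (simp only:)
  then show ?thesis
    using sums_single[of 0 "\<lambda>_. x"] sums_unique2 by blast
qed

text \<open>The diagonal factor stands on the left: each step first makes a transition and then
  weights the state it has reached. This matches Riemann sums with right endpoints.\<close>

lemma matrix_exp_Trotter:
  fixes A :: "real^'n^'n" and d :: "real^'n"
  shows "(\<lambda>n. ((\<lambda>B. (diag_matrix (\<chi> i. exp (s / Suc n * d $ i)) ** matrix_exp ((s / Suc n) *\<^sub>R A)) ** B) ^^ Suc n)
            (mat 1) $ i $ j) \<longlonglongrightarrow> matrix_exp (s *\<^sub>R (A + diag_matrix d)) $ i $ j"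
proof -
  let ?D = "endo_of_matrix (s *\<^sub>R diag_matrix d)" and ?A = "endo_of_matrix (s *\<^sub>R A)"
  have scale: "(1 / real (Suc n)) *\<^sub>R s *\<^sub>R diag_matrix d = diag_matrix (\<chi> i. s / Suc n * d $ i)" for n
    by (simp add: diag_matrix_def vec_eq_iff)
  have "matrix_of_endo ((exp ((1 / Suc n) *\<^sub>R ?D) * exp ((1 / Suc n) *\<^sub>R ?A)) ^ Suc n)
    = ((\<lambda>B. (diag_matrix (\<chi> i. exp (s / Suc n * d $ i)) ** matrix_exp ((s / Suc n) *\<^sub>R A)) ** B) ^^ Suc n)
            (mat 1)" for n
    unfolding matrix_of_endo_power matrix_of_endo_mult linear_cmul[OF endo_of_matrix_linear, symmetric]
      matrix_exp_eq[symmetric] scale matrix_exp_diag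
    by simp
  moreover have "(\<lambda>n. matrix_of_endo ((exp ((1 / Suc n) *\<^sub>R ?D) * exp ((1 / Suc n) *\<^sub>R ?A)) ^ Suc n) $ i $ j)
      \<longlonglongrightarrow> matrix_of_endo (exp (?A + ?D)) $ i $ j"
    by (intro bounded_linear.tendsto[OF bounded_linear_matrix_of_endo_nth] Lie_Trotter)
  moreover have "matrix_exp (s *\<^sub>R (A + diag_matrix d)) = matrix_of_endo (exp (?A + ?D))"
    by (simp add: matrix_exp_eq scaleR_right_distrib linear_add[OF endo_of_matrix_linear])
  ultimately show ?thesis
    by (simp only:)
qed

text \<open>The j-th column sum of \<open>exp (s A)\<close> is constant for \<open>s > 0\<close>, so
  its derivative vanishes there. The derivative at s is the column sum of
  \<open>exp (s A) ** A\<close>, and since \<open>exp (s A)\<close> preserves column sums it equals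
  that of A. It is taken at \<open>s = 1\<close> because the hypothesis speaks of positive s
  only.\<close>

lemma column_sums_zero_if_matrix_exp_stochastic:
  fixes A :: "real^'n^'n"
  assumes "\<And>s j. 0 < s \<Longrightarrow> (\<Sum>i\<in>UNIV. matrix_exp (s *\<^sub>R A) $ i $ j) = 1"
  shows "(\<Sum>i\<in>UNIV. A $ i $ j) = 0"
proof -
  let ?e = "\<lambda>T. \<Sum>i\<in>UNIV. matrix_of_endo T $ i $ j"
  have sum_mult: "(\<Sum>i\<in>UNIV. (matrix_exp (s *\<^sub>R A) ** B) $ i $ j) = (\<Sum>i\<in>UNIV. B $ i $ j)"
    if "0 < s" for s B
  proof -
    have "(\<Sum>i\<in>UNIV. (matrix_exp (s *\<^sub>R A) ** B) $ i $ j)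
        = (\<Sum>k\<in>UNIV. \<Sum>i\<in>UNIV. matrix_exp (s *\<^sub>R A) $ i $ k * B $ k $ j)"
      unfolding matrix_matrix_mult_def vec_lambda_beta by (rule sum.swap)
    also have "\<dots> = (\<Sum>k\<in>UNIV. (\<Sum>i\<in>UNIV. matrix_exp (s *\<^sub>R A) $ i $ k) * B $ k $ j)"
      by (simp only: sum_distrib_right)
    finally show ?thesis using assms[OF that] by simp
  qed
  have "bounded_linear ?e"
    by (intro bounded_linear_sum bounded_linear_matrix_of_endo_nth)
  then have "((\<lambda>s. ?e (exp (s *\<^sub>R endo_of_matrix A))) has_vector_derivative
      ?e (exp (1 *\<^sub>R endo_of_matrix A) * endo_of_matrix A)) (at 1)"
    by (rule bounded_linear.has_vector_derivative[OF _ exp_scaleR_has_vector_derivative_right])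
  moreover have "?e (exp (1 *\<^sub>R endo_of_matrix A) * endo_of_matrix A) = (\<Sum>i\<in>UNIV. A $ i $ j)"
    using sum_mult[of 1 A] by (simp add: matrix_of_endo_mult flip: matrix_exp_eq)
  ultimately have der: "((\<lambda>s. ?e (exp (s *\<^sub>R endo_of_matrix A))) has_vector_derivative (\<Sum>i\<in>UNIV. A $ i $ j)) (at 1)"
    by (simp only:)
  have one: "?e (exp (s *\<^sub>R endo_of_matrix A)) = 1" if "0 < s" for s
    using assms[OF that] by (simp add: matrix_exp_eq linear_cmul[OF endo_of_matrix_linear])
  have "((\<lambda>s. ?e (exp (s *\<^sub>R endo_of_matrix A))) has_vector_derivative 0) (at 1)"
    by (rule has_vector_derivative_transform_within_open[OF has_vector_derivative_const[of 1], of "{0<..}"])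
       (simp_all add: one)
  then show ?thesis
    by (rule vector_derivative_unique_at[OF der])
qed

section \<open>Path space\<close>

lemma space_path_algebra [simp]: "space path_algebra = paths"
  unfolding path_algebra_def by (rule space_measure_of) auto

lemma sets_path_algebra: "sets path_algebra = sigma_sets paths {{w \<in> paths. w t = a} | t a. 0 \<le> t}"
  unfolding path_algebra_def by (rule sets_measure_of) auto

lemma coordinate_measurable [measurable]:
  fixes t :: real
  assumes "0 \<le> t"
  shows "(\<lambda>w :: 'n::finite path. w t) \<in> measurable path_algebra (count_space UNIV)"
proof (rule measurableI)
  fix A :: "'n set"
  have "(\<lambda>w. w t) -` A \<inter> space path_algebra = (\<Union>a\<in>A. {w \<in> paths. w t = a})"
    by auto
  also have "\<dots> \<in> sets path_algebra"
    using assms by (intro sets.finite_UN) (auto simp: sets_path_algebra intro!: sigma_sets.Basic)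
  finally show "(\<lambda>w. w t) -` A \<inter> space path_algebra \<in> sets path_algebra" .
qed auto

lemma measurable_path_algebraI:
  fixes f :: "'a \<Rightarrow> 'n path"
  assumes "f \<in> space M \<rightarrow> paths"
    and "\<And>t a. 0 \<le> t \<Longrightarrow> {w \<in> space M. f w t = a} \<in> sets M"
  shows "f \<in> measurable M path_algebra"
proof (rule measurable_sigma_sets[OF sets_path_algebra])
  fix y :: "'n path set" assume "y \<in> {{w \<in> paths. w t = a} | t a. 0 \<le> t}"
  then obtain t a where y: "y = {w \<in> paths. w t = a}" "0 \<le> t" by auto
  have "f -` y \<inter> space M = {w \<in> space M. f w t = a}"
    using assms(1) y by auto
  then show "f -` y \<inter> space M \<in> sets M" using assms(2) y by simp
qed (use assms(1) in auto)

text \<open>A variant of \<open>cylinder\<close> indexed by a set of times instead of an increasing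
  enumeration: intersecting two of them only takes the union of the sets, with no merging of
  grids.\<close>

definition path_cylinder :: "real set \<Rightarrow> (real \<Rightarrow> 'n) \<Rightarrow> 'n path set" where
  "path_cylinder F b = {w \<in> paths. \<forall>s\<in>F. w s = b s}"

lemma path_cylinder_sets:
  fixes b :: "real \<Rightarrow> 'n::finite"
  assumes "finite F" "F \<subseteq> {0..}"
  shows "path_cylinder F b \<in> sets path_algebra"
proof -
  have "path_cylinder F b = {w \<in> space path_algebra. \<forall>s\<in>F. w s = b s}"
    by (simp add: path_cylinder_def)
  also have "\<dots> \<in> sets path_algebra"
  proof (rule sets.sets_Collect_countable_All'[OF _ countable_finite[OF assms(1)]])
    fix s assume "s \<in> F"
    then have "0 \<le> s" using assms by auto
    then show "{w \<in> space path_algebra. w s = b s} \<in> sets path_algebra"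
      by (auto simp: sets_path_algebra intro!: sigma_sets.Basic)
  qed
  finally show ?thesis .
qed

text \<open>Inserting the largest element last enumerates F in increasing order. This leads from
  \<open>path_cylinder\<close> back to the grids on which measures are prescribed; these start at 0,
  hence \<open>0 \<in> F\<close>.\<close>

lemma ex_time_grid:
  assumes "finite F" "0 \<in> F" "F \<subseteq> {0..}"
  shows "\<exists>r ts. time_grid r ts \<and> ts ` {..r} = F"
  using assms
proof (induction F rule: finite_linorder_max_induct)
  case (insert b F)
  show ?case
  proof (cases "F = {}")
    case True
    with insert.prems show ?thesis
      by (intro exI[of _ 0] exI[of _ "\<lambda>_. 0"]) (auto simp: time_grid_def)
  next
    case False
    then obtain z where "z \<in> F" by auto
    then have "z < b" "0 \<le> z" using insert.hyps insert.prems by auto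
    then have F: "0 \<in> F" "F \<subseteq> {0..}" using insert.prems by auto
    obtain r ts where *: "time_grid r ts" "ts ` {..r} = F" using insert.IH[OF F] by blast
    then have "\<forall>k\<le>r. ts k < b" using insert.hyps by auto
    then have "time_grid (Suc r) (ts(Suc r := b))"
      using *(1) by (auto simp: time_grid_def less_Suc_eq)
    moreover have "(ts(Suc r := b)) ` {..Suc r} = insert b F"
      using *(2) by (auto simp: atMost_Suc)
    ultimately show ?thesis by blast
  qed
qed simp

lemma cylinder_eq_path_cylinder: "path_cylinder (ts ` {..r}) b = cylinder r ts (\<lambda>k. b (ts k))"
  by (auto simp: path_cylinder_def cylinder_def)

lemma time_grid_mono: "time_grid r ts \<Longrightarrow> i \<le> k \<Longrightarrow> k \<le> r \<Longrightarrow> ts i \<le> ts k"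
proof (induction k)
  case (Suc k)
  then show ?case by (cases "i = Suc k") (auto simp: time_grid_def dest!: spec[of _ k])
qed simp

lemma time_grid_strict_mono: 
  assumes "time_grid r ts" "i < k" "k \<le> r"
  shows "ts i < ts k"
proof -
  have "ts i < ts (Suc i)" using assms by (auto simp: time_grid_def)
  also have "\<dots> \<le> ts k" using assms by (intro time_grid_mono) auto
  finally show ?thesis .
qed

lemma time_grid_nonneg: "time_grid r ts \<Longrightarrow> k \<le> r \<Longrightarrow> 0 \<le> ts k"
  using time_grid_mono[of r ts 0 k] by (simp add: time_grid_def)

lemma cylinder_sets:
  fixes a :: "nat \<Rightarrow> 'n::finite"
  assumes "time_grid r ts"
  shows "cylinder r ts a \<in> sets path_algebra"
proof -
  have inj: "inj_on ts {..r}"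
    using time_grid_strict_mono[OF assms] by (intro inj_onI) (metis atMost_iff less_irrefl linorder_neqE_nat)
  have "cylinder r ts a = path_cylinder (ts ` {..r}) (\<lambda>s. a (the_inv_into {..r} ts s))"
    unfolding cylinder_eq_path_cylinder by (auto simp: cylinder_def the_inv_into_f_f[OF inj])
  then show ?thesis
    using path_cylinder_sets[of "ts ` {..r}"] time_grid_nonneg[OF assms] by auto
qed

section \<open>Generating systems of cylinders and uniqueness of measures\<close>

text \<open>Requiring every cylinder to observe the times in T singles out those on which the
  measures in question are known; T will be \<open>{0}\<close> or \<open>{0, t}\<close>. The empty
  set is added because cylinders with conflicting values have an empty intersection.\<close>

definition cylinders_over :: "real set \<Rightarrow> 'n path set set" where
  "cylinders_over T = insert {} {path_cylinder F b | F b. finite F \<and> T \<subseteq> F \<and> F \<subseteq> {0..}}"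

lemma Int_path_cylinder:
  "path_cylinder F b \<inter> path_cylinder G c
    = (if \<forall>s\<in>F \<inter> G. b s = c s then path_cylinder (F \<union> G) (\<lambda>s. if s \<in> F then b s else c s) else {})"
  by (auto simp: path_cylinder_def)

lemma Int_stable_cylinders_over: "Int_stable (cylinders_over T)"
proof (rule Int_stableI)
  fix A B :: "'n path set" assume AB: "A \<in> cylinders_over T" "B \<in> cylinders_over T"
  show "A \<inter> B \<in> cylinders_over T"
  proof (cases "A = {} \<or> B = {}")
    case True
    then show ?thesis by (auto simp: cylinders_over_def)
  next
    case False
    obtain F b where A: "A = path_cylinder F b" "finite F" "T \<subseteq> F" "F \<subseteq> {0..}"
      using False AB(1) unfolding cylinders_over_def by blast
    obtain G c where B: "B = path_cylinder G c" "finite G" "G \<subseteq> {0..}"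
      using False AB(2) unfolding cylinders_over_def by blast
    have "finite (F \<union> G)" "T \<subseteq> F \<union> G" "F \<union> G \<subseteq> {0..}" using A B by auto
    then show ?thesis
      unfolding A B Int_path_cylinder cylinders_over_def by auto
  qed
qed

lemma cylinders_over_sets:
  "cylinders_over T \<subseteq> sets (path_algebra :: 'n::finite path measure)"
  unfolding cylinders_over_def using path_cylinder_sets by auto

text \<open>Splitting an event at one time according to the states at the times of T brings it into
  the family over T, so that this smaller family still generates. Taking b extensional keeps the
  union finite for finite T.\<close>

lemma coordinate_set_eq_Union:
  assumes "0 \<le> t"
  shows "{w \<in> paths. w t = (a :: 'n::finite)}
    = (\<Union>b\<in>{b \<in> insert t T \<rightarrow>\<^sub>E UNIV. b t = a}. path_cylinder (insert t T) b)"
proof -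
  have "w \<in> (\<Union>b\<in>{b \<in> insert t T \<rightarrow>\<^sub>E UNIV. b t = a}. path_cylinder (insert t T) b)"
    if "w \<in> paths" "w t = a" for w
    using that by (intro UN_I[of "restrict w (insert t T)"]) (auto simp: path_cylinder_def)
  then show ?thesis by (auto simp: path_cylinder_def)
qed

lemma paths_eq_Union:
  "(paths :: 'n::finite path set) = (\<Union>b\<in>T \<rightarrow>\<^sub>E UNIV. path_cylinder T b)"
proof -
  have "w \<in> (\<Union>b\<in>T \<rightarrow>\<^sub>E UNIV. path_cylinder T b)" if "w \<in> paths" for w :: "'n path"
    using that by (intro UN_I[of "restrict w T"]) (auto simp: path_cylinder_def)
  then show ?thesis by (auto simp: path_cylinder_def)
qed

lemma sets_path_algebra_cylinders_over:
  assumes "finite T" "T \<subseteq> {0..}"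
  shows "sets (path_algebra :: 'n::finite path measure) = sigma_sets paths (cylinders_over T)"
proof (rule antisym)
  have Pow: "cylinders_over T \<subseteq> Pow (paths :: 'n path set)"
    by (auto simp: cylinders_over_def path_cylinder_def)
  show "sigma_sets paths (cylinders_over T) \<subseteq> sets (path_algebra :: 'n path measure)"
    using sets.sigma_sets_subset[OF cylinders_over_sets, of T] by simp
  show "sets (path_algebra :: 'n path measure) \<subseteq> sigma_sets paths (cylinders_over T)"
    unfolding sets_path_algebra
  proof (rule sigma_sets_mono, safe)
    fix t :: real and a :: 'n assume t: "0 \<le> t"
    interpret sigma_algebra paths "sigma_sets paths (cylinders_over T :: 'n path set set)"
      by (rule sigma_algebra_sigma_sets[OF Pow])
    have "finite (insert t T \<rightarrow>\<^sub>E (UNIV :: 'n set))" using assms by (intro finite_PiE) auto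
    then show "{w \<in> paths. w t = a} \<in> sigma_sets paths (cylinders_over T)"
      unfolding coordinate_set_eq_Union[OF t, of a T] using assms t
      by (intro finite_UN) (auto simp: cylinders_over_def intro!: sigma_sets.Basic)
  qed
qed

text \<open>Uniqueness on an intersection-stable generator. Finiteness is asked on cylinders only,
  and the finitely many cylinders over T itself cover the space; a candidate for the fibre measure
  is not known to be finite in advance.\<close>

lemma measure_eq_on_cylinders_over:
  fixes M N :: "'n::finite path measure"
  assumes "finite T" "T \<subseteq> {0..}" "sets M = sets path_algebra" "sets N = sets path_algebra"
    and eq: "\<And>F b. finite F \<Longrightarrow> T \<subseteq> F \<Longrightarrow> F \<subseteq> {0..} \<Longrightarrow>
        emeasure M (path_cylinder F b) = emeasure N (path_cylinder F b)"
    and fin: "\<And>F b. finite F \<Longrightarrow> T \<subseteq> F \<Longrightarrow> F \<subseteq> {0..} \<Longrightarrow> emeasure M (path_cylinder F b) \<noteq> \<infinity>"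
  shows "M = N"
proof (rule measure_eqI_generator_eq_countable[where E = "cylinders_over T" and \<Omega> = paths
      and A = "path_cylinder T ` (T \<rightarrow>\<^sub>E UNIV)"])
  show "\<Union> (path_cylinder T ` (T \<rightarrow>\<^sub>E UNIV)) = (paths :: 'n path set)"
    by (rule paths_eq_Union[symmetric])
  show "countable (path_cylinder T ` (T \<rightarrow>\<^sub>E (UNIV :: 'n set)))"
    using assms(1) by (intro countable_finite finite_imageI finite_PiE) auto
  show "path_cylinder T ` (T \<rightarrow>\<^sub>E (UNIV :: 'n set)) \<subseteq> cylinders_over T"
    unfolding cylinders_over_def using assms(1,2) by blast
  show "emeasure M X = emeasure N X" if "X \<in> cylinders_over T" for X
    using that eq by (auto simp: cylinders_over_def)
  show "emeasure M X \<noteq> \<infinity>" if "X \<in> path_cylinder T ` (T \<rightarrow>\<^sub>E (UNIV :: 'n set))" for X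
    using that fin assms(1,2) by auto
  show "cylinders_over T \<subseteq> Pow (paths :: 'n path set)"
    by (auto simp: cylinders_over_def path_cylinder_def)
qed (simp_all add: Int_stable_cylinders_over assms(3,4) sets_path_algebra_cylinders_over[OF assms(1,2)])

section \<open>Shifts, fibres and glued paths\<close>

text \<open>Right continuity in a discrete space makes both paths constant immediately after each
  time, and rational times occur there. Equality of paths thus becomes countably many
  conditions.\<close>

lemma path_eqI_rational:
  assumes "w \<in> paths" "x \<in> paths" "\<And>q. q \<in> \<rat> \<Longrightarrow> 0 \<le> q \<Longrightarrow> w q = x q"
  shows "w = x"
proof (rule extensionalityI[of _ "{0..}"])
  show "w \<in> extensional {0..}" "x \<in> extensional {0..}" using assms by (auto simp: paths_def)
  fix t :: real assume "t \<in> {0..}"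
  then have "\<forall>\<^sub>F s in at_right t. w s = w t \<and> x s = x t"
    using assms by (auto simp: paths_def eventually_conj_iff)
  then obtain e where e: "t < e" "\<And>s. t < s \<Longrightarrow> s < e \<Longrightarrow> w s = w t \<and> x s = x t"
    by (auto simp: eventually_at_right[of t "t + 1"])
  obtain q where "q \<in> \<rat>" "t < q" "q < e" using Rats_dense_in_real[OF e(1)] by auto
  then show "w t = x t" using e(2)[of q] assms(3)[of q] \<open>t \<in> {0..}\<close> by auto
qed

lemma eventually_at_right_shift:
  "(\<forall>\<^sub>F s in at_right (u - d). P s) \<longleftrightarrow> (\<forall>\<^sub>F s in at_right u. P (s - d))" for u d :: real
  by (simp add: filtermap_at_right_shift[symmetric] eventually_filtermap)

lemma eventually_at_left_shift:
  "(\<forall>\<^sub>F s in at_left (u - d). P s) \<longleftrightarrow> (\<forall>\<^sub>F s in at_left u. P (s - d))" for u d :: real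
  by (simp add: eventually_at_filter filtermap_nhds_shift[symmetric] eventually_filtermap)

lemma path_right_continuous: "w \<in> paths \<Longrightarrow> 0 \<le> u \<Longrightarrow> \<forall>\<^sub>F s in at_right u. w s = w u"
  by (simp add: paths_def)

lemma path_left_limit: "w \<in> paths \<Longrightarrow> 0 < u \<Longrightarrow> \<exists>a. \<forall>\<^sub>F s in at_left u. w s = a"
  by (simp add: paths_def)

lemma path_shift_paths:
  assumes w: "w \<in> paths" and "0 \<le> t"
  shows "path_shift t w \<in> paths"
proof -
  have "\<forall>\<^sub>F s in at_right u. path_shift t w s = path_shift t w u" if u: "0 \<le> u" for u
  proof -
    have "\<forall>\<^sub>F s in at_right u. w (s + t) = w (u + t)"
      using path_right_continuous[OF w, of "u + t"] eventually_at_right_shift[where u = u and d = "- t"] assms u by simp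
    with eventually_at_right_less[of u] show ?thesis
      by eventually_elim (use u in \<open>simp add: path_shift_def\<close>)
  qed
  moreover have "\<exists>a. \<forall>\<^sub>F s in at_left u. path_shift t w s = a" if u: "0 < u" for u
  proof -
    obtain a where "\<forall>\<^sub>F s in at_left u. w (s + t) = a"
      using path_left_limit[OF w, of "u + t"] eventually_at_left_shift[where u = u and d = "- t"] assms u by auto
    with eventually_at_left_real[OF u] have "\<forall>\<^sub>F s in at_left u. path_shift t w s = a"
      by eventually_elim (simp add: path_shift_def)
    then show ?thesis ..
  qed
  ultimately show ?thesis by (simp add: paths_def path_shift_def)
qed

lemma shift_fiber_sets:
  fixes x :: "'n::finite path"
  assumes "x \<in> paths" "0 \<le> t"
  shows "{w \<in> paths. path_shift t w = x} \<in> sets path_algebra"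
proof -
  have "{w \<in> paths. path_shift t w = x} = {w \<in> space path_algebra. \<forall>q\<in>\<rat> \<inter> {0..}. w (q + t) = x q}"
    using assms path_eqI_rational[OF path_shift_paths _]
    by (auto simp: path_shift_def)
  also have "\<dots> = (\<Inter>q\<in>\<rat> \<inter> {0..}. {w \<in> space path_algebra. w (q + t) = x q})"
    using Rats_0 by (auto intro!: exI[of _ 0])
  also have "\<dots> \<in> sets path_algebra"
  proof (rule sets.countable_INT'[OF _ _ image_subsetI])
    show "\<rat> \<inter> {0 :: real..} \<noteq> {}" by (auto intro!: exI[of _ 0])
    show "countable (\<rat> \<inter> {0 :: real..})" by (simp add: countable_rat)
    fix q :: real assume "q \<in> \<rat> \<inter> {0..}"
    then show "{w \<in> space path_algebra. w (q + t) = x q} \<in> sets path_algebra"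
      using assms by (auto simp: sets_path_algebra intro!: sigma_sets.Basic)
  qed
  finally show ?thesis .
qed

text \<open>At time \<open>t\<close> the value is taken from x, so right continuity holds there for
  any w; the left limit at \<open>t\<close> comes from w. The two pieces need not match: agreement
  with w up to and including \<open>t\<close> requires \<open>w t = x 0\<close>.\<close>

definition glue :: "real \<Rightarrow> 'n path \<Rightarrow> 'n path \<Rightarrow> 'n path" where
  "glue t x w = (\<lambda>s\<in>{0..}. if s < t then w s else x (s - t))"

lemma path_shift_glue: "x \<in> paths \<Longrightarrow> 0 \<le> t \<Longrightarrow> path_shift t (glue t x w) = x"
  by (auto simp: path_shift_def glue_def paths_def extensional_def intro!: ext)

lemma glue_paths:
  assumes "x \<in> paths" "w \<in> paths" "0 < t"
  shows "glue t x w \<in> paths"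
proof -
  have "\<forall>\<^sub>F s in at_right u. glue t x w s = glue t x w u" if u: "0 \<le> u" for u
  proof (cases "u < t")
    case True
    from path_right_continuous[OF \<open>w \<in> paths\<close> u] eventually_at_right_real[OF True]
    show ?thesis by eventually_elim (use u True in \<open>simp add: glue_def\<close>)
  next
    case False
    then have "\<forall>\<^sub>F s in at_right u. x (s - t) = x (u - t)"
      using path_right_continuous[OF \<open>x \<in> paths\<close>, of "u - t"] by (simp add: eventually_at_right_shift)
    with eventually_at_right_less[of u] show ?thesis
      by eventually_elim (use u False in \<open>simp add: glue_def\<close>)
  qed
  moreover have "\<exists>a. \<forall>\<^sub>F s in at_left u. glue t x w s = a" if u: "0 < u" for u
  \<comment> \<open>For left limits the boundary case \<open>u = t\<close> belongs to w, whereas for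
    right limits it belongs to x.\<close>
  proof (cases "u \<le> t")
    case True
    obtain a where "\<forall>\<^sub>F s in at_left u. w s = a"
      using path_left_limit[OF \<open>w \<in> paths\<close> u] by auto
    with eventually_at_left_real[OF u] have "\<forall>\<^sub>F s in at_left u. glue t x w s = a"
      by eventually_elim (use True in \<open>simp add: glue_def\<close>)
    then show ?thesis ..
  next
    case False
    then obtain a where "\<forall>\<^sub>F s in at_left u. x (s - t) = a"
      using path_left_limit[OF \<open>x \<in> paths\<close>, of "u - t"] by (auto simp: eventually_at_left_shift)
    moreover have "\<forall>\<^sub>F s in at_left u. s \<in> {t<..<u}"
      using False by (intro eventually_at_left_real) simp
    ultimately have "\<forall>\<^sub>F s in at_left u. glue t x w s = a"
      by eventually_elim (use \<open>0 < t\<close> in \<open>simp add: glue_def\<close>)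
    then show ?thesis ..
  qed
  ultimately show ?thesis by (auto simp: paths_def glue_def)
qed

lemma glue_measurable:
  fixes x :: "'n::finite path"
  assumes "x \<in> paths" "0 < t"
  shows "glue t x \<in> measurable path_algebra path_algebra"
proof (rule measurable_path_algebraI)
  show "glue t x \<in> space path_algebra \<rightarrow> paths" using glue_paths assms by auto
  fix s :: real and a :: 'n assume [simp]: "0 \<le> s"
  have [measurable]: "(\<lambda>w :: 'n path. w s) \<in> measurable path_algebra (count_space UNIV)"
    by (rule coordinate_measurable) simp
  show "{w \<in> space path_algebra. glue t x w s = a} \<in> sets path_algebra"
    by (cases "s < t") (simp_all add: glue_def del: space_path_algebra)
qed

section \<open>Riemann sums along paths\<close>

text \<open>The sums are exact integrals of the step functions \<open>f (\<sigma> n s)\<close>,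
  where \<open>\<sigma> n s\<close> is the right endpoint of the grid cell of s. These endpoints
  tend to s strictly from the right, so \<open>f (\<sigma> n s) = f s\<close> eventually, and
  dominated convergence gives integrability together with the limit.\<close>

lemma right_riemann_sums_converge:
  fixes f :: "real \<Rightarrow> real"
  assumes ab: "a < b"
    and rc: "\<And>s. a \<le> s \<Longrightarrow> \<forall>\<^sub>F u in at_right s. f u = f s"
    and bound: "\<And>s. a \<le> s \<Longrightarrow> \<bar>f s\<bar> \<le> B"
  shows "f integrable_on {a..b}"
    and "(\<lambda>n. \<Sum>k<Suc n. f (a + real (Suc k) * ((b - a) / Suc n)) * ((b - a) / Suc n))
      \<longlonglongrightarrow> integral {a..b} f"
proof -
  define h where "h n = (b - a) / real (Suc n)" for n
  \<comment> \<open>Cells are closed on the left and open on the right. Hence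
    \<open>\<sigma> n s\<close> always exceeds s, and \<open>\<sigma> n b = b + h n\<close> lies
    beyond the interval; this is why f is bounded on all of \<open>s \<ge> a\<close>.\<close>
  define \<sigma> where "\<sigma> n s = a + (of_int \<lfloor>(s - a) / h n\<rfloor> + 1) * h n" for n s
  have h: "0 < h n" for n using ab by (simp add: h_def)
  have step: "((\<lambda>s. f (\<sigma> n s)) has_integral (\<Sum>k<m. f (a + real (Suc k) * h n) * h n)) {a..a + real m * h n}" for n m
  proof (induction m)
    case 0
    then show ?case by (simp add: has_integral_refl(2)[of _ a, simplified])
  next
    case (Suc m)
    let ?c = "a + real m * h n" and ?d = "a + real (Suc m) * h n"
    have cd: "?c \<le> ?d" "a \<le> ?c" using h[of n] by (simp_all add: algebra_simps)
    have "((\<lambda>_. f ?d) has_integral (?d - ?c) *\<^sub>R f ?d) {?c..?d}"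
      using has_integral_const_real[of "f ?d" ?c ?d] cd by simp
    \<comment> \<open>At the right end of the cell the floor jumps to the next value; that single
      point is discarded, which the integral does not notice.\<close>
    moreover have "f (\<sigma> n s) = f ?d" if "s \<in> {?c..?d} - {?d}" for s
    proof -
      have "?c \<le> s" "s < ?d" using that by auto
      then have "real m \<le> (s - a) / h n" "(s - a) / h n < real m + 1"
        using h[of n] by (simp_all add: pos_le_divide_eq pos_divide_less_eq algebra_simps)
      then have "\<lfloor>(s - a) / h n\<rfloor> = int m" by (intro floor_unique) simp_all
      then show ?thesis by (simp add: \<sigma>_def add.commute)
    qed
    ultimately have "((\<lambda>s. f (\<sigma> n s)) has_integral (?d - ?c) *\<^sub>R f ?d) {?c..?d}"
      by (intro has_integral_spike_finite[of "{?d}" "{?c..?d}" "\<lambda>s. f (\<sigma> n s)" "\<lambda>_. f ?d"]) simp_all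
    from has_integral_combine[OF cd(2,1) Suc.IH this] show ?case
      by (simp add: algebra_simps)
  qed
  have end_eq: "a + real (Suc n) * h n = b" for n by (simp add: h_def)
  have int: "((\<lambda>s. f (\<sigma> n s)) has_integral (\<Sum>k<Suc n. f (a + real (Suc k) * h n) * h n)) {a..b}" for n
    using step[of n "Suc n"] unfolding end_eq .
  have sig: "s < \<sigma> n s" "\<sigma> n s \<le> s + h n" for n s
  proof -
    have "(s - a) / h n < of_int \<lfloor>(s - a) / h n\<rfloor> + 1" by linarith
    then show "s < \<sigma> n s" using h[of n] by (simp add: \<sigma>_def field_simps)
    have "of_int \<lfloor>(s - a) / h n\<rfloor> \<le> (s - a) / h n" by linarith
    then have "of_int \<lfloor>(s - a) / h n\<rfloor> * h n \<le> s - a"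
      using h[of n] by (simp only: pos_le_divide_eq)
    then show "\<sigma> n s \<le> s + h n" by (simp add: \<sigma>_def distrib_right)
  qed
  have h0: "h \<longlonglongrightarrow> 0"
    unfolding h_def by (intro LIMSEQ_Suc[of "\<lambda>n. (b - a) / real n"] lim_const_over_n)
  have conv: "(\<lambda>n. f (\<sigma> n s)) \<longlonglongrightarrow> f s" if "s \<in> {a..b}" for s
  proof (rule tendsto_eventually)
    have "(\<lambda>n. \<sigma> n s) \<longlonglongrightarrow> s"
    proof (rule tendsto_sandwich[OF always_eventually always_eventually tendsto_const])
      show "(\<lambda>n. s + h n) \<longlonglongrightarrow> s" using tendsto_add[OF tendsto_const h0, of s] by simp
    qed (simp_all add: sig less_imp_le)
    then have "filterlim (\<lambda>n. \<sigma> n s) (at_right s) sequentially"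
      using sig(1) by (simp add: filterlim_at less_imp_neq[symmetric])
    moreover have "\<forall>\<^sub>F u in at_right s. f u = f s" using rc that by simp
    ultimately show "\<forall>\<^sub>F n in sequentially. f (\<sigma> n s) = f s"
      by (rule eventually_compose_filterlim[rotated])
  qed
  have dom: "norm (f (\<sigma> n s)) \<le> B" if "s \<in> {a..b}" for n s
    using sig(1)[of s n] that bound[of "\<sigma> n s"] by auto
  have fint: "(\<lambda>s. f (\<sigma> n s)) integrable_on {a..b}" for n
    using int by blast
  note dc = dominated_convergence[OF fint integrable_const_ivl dom conv]
  show "f integrable_on {a..b}" by (rule dc(1))
  have "integral {a..b} (\<lambda>s. f (\<sigma> n s)) = (\<Sum>k<Suc n. f (a + real (Suc k) * h n) * h n)" for n
    by (rule integral_unique[OF int])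
  then show "(\<lambda>n. \<Sum>k<Suc n. f (a + real (Suc k) * ((b - a) / Suc n)) * ((b - a) / Suc n))
      \<longlonglongrightarrow> integral {a..b} f"
    using dc(2) unfolding h_def by (simp only:)
qed

lemma path_riemann_sums:
  fixes w :: "'n::finite path" and v :: "real^'n"
  assumes "w \<in> paths" "0 \<le> a" "a < b"
  shows "(\<lambda>s. v $ w s) integrable_on {a..b}"
    and "(\<lambda>n. \<Sum>k<Suc n. v $ w (a + real (Suc k) * ((b - a) / Suc n)) * ((b - a) / Suc n))
      \<longlonglongrightarrow> integral {a..b} (\<lambda>s. v $ w s)"
proof -
  have rc: "\<forall>\<^sub>F u in at_right s. v $ w u = v $ w s" if "a \<le> s" for s
    using path_right_continuous[OF assms(1), of s] assms(2) that by (auto elim: eventually_mono)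
  have bd: "\<bar>v $ w s\<bar> \<le> norm v" for s by (rule component_le_norm_cart)
  show "(\<lambda>s. v $ w s) integrable_on {a..b}"
    by (rule right_riemann_sums_converge(1)[OF assms(3) rc bd])
  show "(\<lambda>n. \<Sum>k<Suc n. v $ w (a + real (Suc k) * ((b - a) / Suc n)) * ((b - a) / Suc n))
      \<longlonglongrightarrow> integral {a..b} (\<lambda>s. v $ w s)"
    by (rule right_riemann_sums_converge(2)[OF assms(3) rc bd])
qed

lemma path_integral_bound:
  fixes w :: "'n::finite path" and v :: "real^'n"
  assumes "w \<in> paths" "0 \<le> t"
  shows "\<bar>integral {0..t} (\<lambda>s. v $ w s)\<bar> \<le> norm v * t"
proof (cases "t = 0")
  case False
  then have "(\<lambda>s. v $ w s) integrable_on {0..t}"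
    using assms by (intro path_riemann_sums(1)) auto
  then have "norm (integral {0..t} (\<lambda>s. v $ w s)) \<le> integral {0..t} (\<lambda>_. norm v)"
    by (rule integral_norm_bound_integral) (auto simp: component_le_norm_cart)
  then show ?thesis using assms by (simp add: mult.commute)
qed simp

lemma path_integral_measurable [measurable]:
  fixes v :: "real^'n"
  assumes "0 < t"
  shows "(\<lambda>w. integral {0..t} (\<lambda>s. v $ w s)) \<in> borel_measurable path_algebra"
proof (rule borel_measurable_LIMSEQ_real)
  fix w :: "'n path" assume "w \<in> space path_algebra"
  then show "(\<lambda>n. \<Sum>k<Suc n. v $ w (0 + real (Suc k) * ((t - 0) / Suc n)) * ((t - 0) / Suc n))
      \<longlonglongrightarrow> integral {0..t} (\<lambda>s. v $ w s)"
    using assms by (intro path_riemann_sums(2)[of w 0 t v]) auto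
next
  fix n
  have v: "(\<lambda>w. v $ w s) \<in> borel_measurable path_algebra" if "0 \<le> s" for s
    by (rule measurable_compose[OF coordinate_measurable[OF that]]) simp
  show "(\<lambda>w. \<Sum>k<Suc n. v $ w (0 + real (Suc k) * ((t - 0) / Suc n)) * ((t - 0) / Suc n))
      \<in> borel_measurable path_algebra"
  proof (intro borel_measurable_sum borel_measurable_times v)
    show "0 \<le> 0 + real (Suc k) * ((t - 0) / real (Suc n))" for k
      using assms by simp
  qed simp
qed

section \<open>The Feynman-Kac formula on cylinders\<close>

text \<open>Forward vectors of a weighted chain with initial weights q and kernel K: component i is
  the integral of the product of the weights \<open>h 0\<close>, ..., \<open>h m\<close> along the
  path, over the event that the state at \<open>ts m\<close> is i.\<close>

primrec propagate ::
    "(real \<Rightarrow> real^'n^'n) \<Rightarrow> real^'n \<Rightarrow> (nat \<Rightarrow> real) \<Rightarrow> (nat \<Rightarrow> 'n \<Rightarrow> real) \<Rightarrow> nat \<Rightarrow> real^'n" where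
  "propagate K q ts h 0 = (\<chi> i. h 0 i * q $ i)"
| "propagate K q ts h (Suc m) = (\<chi> i. h (Suc m) i * (K (ts (Suc m) - ts m) *v propagate K q ts h m) $ i)"

lemma coordinate_product_integrable:
  fixes M :: "'n::finite path measure" and h :: "nat \<Rightarrow> 'n \<Rightarrow> real"
  assumes "finite_measure M" "sets M = sets path_algebra" "time_grid r ts" "m \<le> r" "A \<in> sets path_algebra"
  shows "integrable M (\<lambda>w. (\<Prod>k\<le>m. h k (w (ts k))) * indicator A w)"
proof -
  interpret finite_measure M by fact
  have coord: "(\<lambda>w. h k (w (ts k))) \<in> borel_measurable M" if "k \<le> m" for k
  proof -
    have "0 \<le> ts k" using time_grid_nonneg[OF assms(3), of k] that assms(4) by simp
    then show ?thesis
      unfolding measurable_cong_sets[OF assms(2) refl]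
      by (rule measurable_compose[OF coordinate_measurable]) simp
  qed
  show ?thesis
  proof (rule integrable_real_mult_indicator)
    show "A \<in> sets M" using assms by simp
    show "integrable M (\<lambda>w. \<Prod>k\<le>m. h k (w (ts k)))"
    proof (rule integrable_const_bound)
      have "norm (\<Prod>k\<le>m. h k (w (ts k))) \<le> (\<Prod>k\<le>m. \<Sum>i\<in>UNIV. \<bar>h k i\<bar>)" for w
        unfolding real_norm_def abs_prod
        by (intro prod_mono) (auto intro: member_le_sum)
      then show "AE w in M. norm (\<Prod>k\<le>m. h k (w (ts k))) \<le> (\<Prod>k\<le>m. \<Sum>i\<in>UNIV. \<bar>h k i\<bar>)"
        by simp
      show "(\<lambda>w. \<Prod>k\<le>m. h k (w (ts k))) \<in> borel_measurable M"
        by (intro borel_measurable_prod) (simp add: coord)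
    qed
  qed
qed

lemma cylinder_subset_paths: "cylinder r ts a \<subseteq> paths"
  by (auto simp: cylinder_def)

lemma tail_cylinder_sets:
  fixes a :: "nat \<Rightarrow> 'n::finite"
  assumes "time_grid r ts"
  shows "{w \<in> paths. \<forall>k\<in>{m..r}. w (ts k) = a k} \<in> sets path_algebra"
proof -
  have "{w \<in> space path_algebra. \<forall>k\<in>{m..r}. w (ts k) = a k} \<in> sets path_algebra"
  proof (rule sets.sets_Collect_countable_All')
    fix k assume "k \<in> {m..r}"
    then show "{w \<in> space path_algebra. w (ts k) = a k} \<in> sets path_algebra"
      using time_grid_nonneg[OF assms, of k] by (auto simp: sets_path_algebra intro!: sigma_sets.Basic)
  qed simp
  then show ?thesis by simp
qed

text \<open>Values are given only for cylinders that fix the state at every time of the grid. The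
  induction starts there and releases one time after another: while the product over
  \<open>k \<le> m\<close> is integrated, the states from index m on stay fixed.\<close>

lemma discrete_path_expectation:
  fixes M :: "'n::finite path measure" and h :: "nat \<Rightarrow> 'n \<Rightarrow> real"
  assumes "finite_measure M" "sets M = sets path_algebra" "time_grid r ts" "m \<le> r"
    and cyl: "\<And>a. measure M (cylinder r ts a) = chain_weight K q r ts a"
  shows "(\<integral>w. (\<Prod>k\<le>m. h k (w (ts k))) * indicator {w \<in> paths. \<forall>k\<in>{m..r}. w (ts k) = a k} w \<partial>M)
    = propagate K q ts h m $ a m * (\<Prod>k\<in>{m..<r}. K (ts (Suc k) - ts k) $ a (Suc k) $ a k)"
  using \<open>m \<le> r\<close>
proof (induction m arbitrary: a)
  case 0
  have "(\<integral>w. (\<Prod>k\<le>0. h k (w (ts k))) * indicator {w \<in> paths. \<forall>k\<in>{0..r}. w (ts k) = a k} w \<partial>M)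
      = (\<integral>w. h 0 (a 0) * indicator (cylinder r ts a) w \<partial>M)"
    by (intro Bochner_Integration.integral_cong) (auto simp: cylinder_def split: split_indicator)
  also have "\<dots> = h 0 (a 0) * chain_weight K q r ts a"
    using cylinder_sets[OF assms(3)] cylinder_subset_paths[of r ts a]
    by (simp add: cyl assms(2) sets_eq_imp_space_eq[OF assms(2)] Int_absorb2)
  finally show ?case by (simp add: chain_weight_def atLeast0LessThan)
next
  case (Suc m)
  let ?T = "\<lambda>m a. {w \<in> paths. \<forall>k\<in>{m..r}. w (ts k) = a k}"
  \<comment> \<open>The state b at index m is released by summing over it, and only
    \<open>b = w (ts m)\<close> can contribute. The new weight is constant because the state at
    index \<open>Suc m\<close> is still fixed.\<close>
  have split: "(\<Prod>k\<le>Suc m. h k (w (ts k))) * indicator (?T (Suc m) a) w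
      = (\<Sum>b\<in>UNIV. h (Suc m) (a (Suc m)) * ((\<Prod>k\<le>m. h k (w (ts k))) * indicator (?T m (a(m := b))) w))" for w
  proof -
    have "indicator (?T m (a(m := b))) w = (if b = w (ts m) then indicator (?T (Suc m) a) w else (0::real))" for b
    proof -
      have "{m..r} = insert m {Suc m..r}" using Suc.prems by auto
      then show ?thesis by (auto split: split_indicator)
    qed
    moreover have "h (Suc m) (w (ts (Suc m))) * indicator (?T (Suc m) a) w
        = h (Suc m) (a (Suc m)) * indicator (?T (Suc m) a) w"
      using Suc.prems by (auto split: split_indicator)
    ultimately show ?thesis
      by (simp add: if_distrib[of "\<lambda>x. _ * x"] mult.assoc cong: if_cong)
  qed
  have "(\<integral>w. (\<Prod>k\<le>Suc m. h k (w (ts k))) * indicator (?T (Suc m) a) w \<partial>M)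
      = (\<Sum>b\<in>UNIV. h (Suc m) (a (Suc m)) *
          (\<integral>w. (\<Prod>k\<le>m. h k (w (ts k))) * indicator (?T m (a(m := b))) w \<partial>M))"
    unfolding split
  proof (subst Bochner_Integration.integral_sum)
    fix b
    have "integrable M (\<lambda>w. (\<Prod>k\<le>m. h k (w (ts k))) * indicator (?T m (a(m := b))) w)"
      using Suc.prems
      by (intro coordinate_product_integrable[OF assms(1,2,3)] tail_cylinder_sets[OF assms(3)]) simp
    then show "integrable M (\<lambda>w. h (Suc m) (a (Suc m)) *
        ((\<Prod>k\<le>m. h k (w (ts k))) * indicator (?T m (a(m := b))) w))"
      by (rule integrable_mult_right)
  qed (simp only: integral_mult_right_zero)
  also have "\<dots> = (\<Sum>b\<in>UNIV. h (Suc m) (a (Suc m)) * (propagate K q ts h m $ b *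
      (K (ts (Suc m) - ts m) $ a (Suc m) $ b * (\<Prod>k\<in>{Suc m..<r}. K (ts (Suc k) - ts k) $ a (Suc k) $ a k))))"
  proof (rule sum.cong[OF refl])
    fix b
    have "(\<Prod>k\<in>{m..<r}. K (ts (Suc k) - ts k) $ (a(m := b)) (Suc k) $ (a(m := b)) k)
      = K (ts (Suc m) - ts m) $ a (Suc m) $ b * (\<Prod>k\<in>{Suc m..<r}. K (ts (Suc k) - ts k) $ a (Suc k) $ a k)"
      using Suc.prems by (subst prod.atLeast_Suc_lessThan) (auto intro!: prod.cong)
    then show "h (Suc m) (a (Suc m)) * (\<integral>w. (\<Prod>k\<le>m. h k (w (ts k))) * indicator (?T m (a(m := b))) w \<partial>M)
      = h (Suc m) (a (Suc m)) * (propagate K q ts h m $ b *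
      (K (ts (Suc m) - ts m) $ a (Suc m) $ b * (\<Prod>k\<in>{Suc m..<r}. K (ts (Suc k) - ts k) $ a (Suc k) $ a k)))"
      using Suc.IH[of "a(m := b)"] Suc.prems by simp
  qed
  also have "\<dots> = propagate K q ts h (Suc m) $ a (Suc m) * (\<Prod>k\<in>{Suc m..<r}. K (ts (Suc k) - ts k) $ a (Suc k) $ a k)"
    by (simp add: matrix_vector_mult_def sum_distrib_left sum_distrib_right mult_ac)
  finally show ?case .
qed

section \<open>Equidistant refinement of time grids\<close>

text \<open>\<open>m div N\<close> numbers the coarse interval and \<open>m mod N\<close> the piece
  inside it. At \<open>m = j * N\<close> the increment after \<open>ts j\<close> is multiplied by 0,
  so times beyond index j do not enter there.\<close>

definition refine_grid :: "nat \<Rightarrow> (nat \<Rightarrow> real) \<Rightarrow> nat \<Rightarrow> real" where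
  "refine_grid N ts m = ts (m div N) + real (m mod N) * ((ts (Suc (m div N)) - ts (m div N)) / N)"

text \<open>The case \<open>k = N\<close> is included although \<open>div\<close> and
  \<open>mod\<close> attribute that point to the next interval: right endpoints have to be expressed
  within the interval that they close.\<close>

lemma refine_grid_eq:
  assumes "0 < N" "k \<le> N"
  shows "refine_grid N ts (i * N + k) = ts i + real k * ((ts (Suc i) - ts i) / N)"
proof (cases "k = N")
  case True
  then have "i * N + k = Suc i * N" by simp
  with assms True show ?thesis unfolding refine_grid_def by simp
qed (use assms in \<open>simp add: refine_grid_def\<close>)

lemma refine_grid_mult: "0 < N \<Longrightarrow> refine_grid N ts (i * N) = ts i"
  using refine_grid_eq[of N 0 ts i] by simp

lemma refine_grid_step:
  assumes "0 < N"
  shows "refine_grid N ts (Suc m) - refine_grid N ts m = (ts (Suc (m div N)) - ts (m div N)) / N"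
proof -
  have "m mod N < N" using assms by simp
  then show ?thesis
    using refine_grid_eq[OF assms, of "Suc (m mod N)" ts "m div N"] 
      refine_grid_eq[OF assms, of "m mod N" ts "m div N"]
    by (simp add: algebra_simps add_divide_distrib diff_divide_distrib)
qed

lemma time_grid_refine:
  assumes "0 < N" "time_grid j ts"
  shows "time_grid (j * N) (refine_grid N ts)"
  unfolding time_grid_def
proof (intro conjI allI impI)
  show "refine_grid N ts 0 = 0" using assms by (simp add: refine_grid_def time_grid_def)
  fix m assume "m < j * N"
  then have "m div N < j" using assms(1) by (simp add: less_mult_imp_div_less)
  then have "0 < refine_grid N ts (Suc m) - refine_grid N ts m"
    unfolding refine_grid_step[OF assms(1)] using assms by (auto simp: time_grid_def)
  then show "refine_grid N ts m < refine_grid N ts (Suc m)" by simp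
qed

lemma sum_blocks: "(\<Sum>m<j * N. g m) = (\<Sum>i<j. \<Sum>k<N. g (i * N + k))" for g :: "nat \<Rightarrow> real"
proof (induction j)
  case (Suc j)
  have "(\<Sum>m<c + N. g m) = (\<Sum>m<c. g m) + (\<Sum>k<N. g (c + k))" for c
    by (induction N) simp_all
  from this[of "j * N"] show ?case using Suc by (simp add: add.commute)
qed simp

text \<open>The mesh is equidistant only inside each coarse interval, so the sum is separated into
  one Riemann sum per interval and the limits are joined by additivity of the integral.\<close>

lemma refined_riemann_sum_tendsto:
  fixes w :: "'n::finite path" and v :: "real^'n"
  assumes w: "w \<in> paths" and grid: "time_grid j ts"
  shows "(\<lambda>n. \<Sum>m<j * Suc n. v $ w (refine_grid (Suc n) ts (Suc m)) *
      ((ts (Suc (m div Suc n)) - ts (m div Suc n)) / Suc n)) \<longlonglongrightarrow> integral {0..ts j} (\<lambda>s. v $ w s)"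
proof -
  let ?\<Delta> = "\<lambda>i. ts (Suc i) - ts i"
  have nonneg: "0 \<le> ts i" "ts i < ts (Suc i)" if "i < j" for i
    using that grid time_grid_nonneg[OF grid, of i] by (auto simp: time_grid_def)
  have "(\<Sum>m<j * Suc n. v $ w (refine_grid (Suc n) ts (Suc m)) * (?\<Delta> (m div Suc n) / Suc n))
      = (\<Sum>i<j. \<Sum>k<Suc n. v $ w (ts i + real (Suc k) * (?\<Delta> i / Suc n)) * (?\<Delta> i / Suc n))" for n
    unfolding sum_blocks
  proof (intro sum.cong refl arg_cong2[where f = "(*)"] arg_cong[where f = "\<lambda>x. v $ w x"])
    fix i k assume k: "k \<in> {..<Suc n}"
    show "refine_grid (Suc n) ts (Suc (i * Suc n + k)) = ts i + real (Suc k) * (?\<Delta> i / Suc n)"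
      using refine_grid_eq[of "Suc n" "Suc k" ts i] k by (simp del: of_nat_Suc mult_Suc_right)
    have "(i * Suc n + k) div Suc n = i" using k by (simp del: mult_Suc_right)
    then show "?\<Delta> ((i * Suc n + k) div Suc n) / Suc n = ?\<Delta> i / Suc n" by simp
  qed
  moreover have "(\<lambda>n. \<Sum>i<j. \<Sum>k<Suc n. v $ w (ts i + real (Suc k) * (?\<Delta> i / Suc n)) * (?\<Delta> i / Suc n))
      \<longlonglongrightarrow> (\<Sum>i<j. integral {ts i..ts (Suc i)} (\<lambda>s. v $ w s))"
    using nonneg by (intro tendsto_sum path_riemann_sums(2)[OF w]) auto
  moreover have "m \<le> j \<Longrightarrow> (\<Sum>i<m. integral {ts i..ts (Suc i)} (\<lambda>s. v $ w s)) = integral {0..ts m} (\<lambda>s. v $ w s)" for m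
  proof (induction m)
    case 0
    then show ?case using grid by (simp add: time_grid_def)
  next
    case (Suc m)
    have "(\<lambda>s. v $ w s) integrable_on {0..ts (Suc m)}"
      using nonneg[of m] Suc.prems w by (intro path_riemann_sums(1)) auto
    then have "integral {0..ts m} (\<lambda>s. v $ w s) + integral {ts m..ts (Suc m)} (\<lambda>s. v $ w s)
        = integral {0..ts (Suc m)} (\<lambda>s. v $ w s)"
      using nonneg[of m] Suc.prems by (intro Henstock_Kurzweil_Integration.integral_combine) auto
    then show ?case using Suc by simp
  qed
  ultimately show ?thesis by simp
qed

text \<open>At coarse times the weight h pins the state, so the forward vector there is a multiple
  of the basis vector of \<open>a i\<close>. In between, the step matrix acts N times, and pinning
  both ends selects one entry of its N-th power, which is the expression treated by the Trotter
  limit.\<close>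

lemma propagate_block:
  fixes K :: "real \<Rightarrow> real^'n^'n" and q v :: "real^'n" and a :: "nat \<Rightarrow> 'n" and ts :: "nat \<Rightarrow> real"
  assumes N: "0 < N"
  defines "\<Delta> \<equiv> \<lambda>i. (ts (Suc i) - ts i) / real N"
  defines "h \<equiv> \<lambda>m s. (if N dvd m then of_bool (s = a (m div N)) else 1) *
      (if m = 0 then 1 else exp (\<Delta> ((m - 1) div N) * v $ s))"
  defines "Mat \<equiv> \<lambda>i. diag_matrix (\<chi> s. exp (\<Delta> i * v $ s)) ** K (\<Delta> i)"
  shows "propagate K q (refine_grid N ts) h (i * N)
    = ((\<Prod>l<i. ((\<lambda>B. Mat l ** B) ^^ N) (mat 1) $ a (Suc l) $ a l) * q $ a 0) *\<^sub>R axis (a i) 1"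
proof (induction i)
  case 0
  show ?case by (simp add: h_def vec_eq_iff axis_def)
next
  case (Suc i)
  let ?p = "propagate K q (refine_grid N ts) h"
  let ?c = "(\<Prod>l<i. ((\<lambda>B. Mat l ** B) ^^ N) (mat 1) $ a (Suc l) $ a l) * q $ a 0"
  have diag: "(diag_matrix d *v x) $ s = d $ s * x $ s" for d x :: "real^'n" and s
    by (simp add: diag_matrix_def matrix_vector_mult_def if_distrib[of "\<lambda>y. y * _"] cong: if_cong)
  have step: "?p (Suc (i * N + k)) = (\<chi> s. (if Suc k = N then of_bool (s = a (Suc i)) else 1) *
      (Mat i *v ?p (i * N + k)) $ s)" if k: "k < N" for k
  proof -
    have div: "(i * N + k) div N = i" using k by simp
    have "N dvd Suc (i * N + k) \<longleftrightarrow> Suc k = N"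
    proof
      assume "N dvd Suc (i * N + k)"
      then have "N dvd Suc k" using dvd_add_right_iff[of N "i * N" "Suc k"] by simp
      then show "Suc k = N" using k by (auto dest: dvd_imp_le)
    next
      assume "Suc k = N"
      then have "Suc (i * N + k) = Suc i * N" by simp
      then show "N dvd Suc (i * N + k)" by (simp only: dvd_triv_right)
    qed
    moreover have "Suc (i * N + k) div N = Suc i" if "Suc k = N"
    proof -
      have "Suc (i * N + k) = Suc i * N" using that by simp
      then show ?thesis using N by (simp only: nonzero_mult_div_cancel_right)
    qed
    ultimately show ?thesis
      by (simp add: vec_eq_iff h_def div refine_grid_step[OF N] Mat_def \<Delta>_def diag
          flip: matrix_vector_mul_assoc)
  qed
  have inner: "k < N \<Longrightarrow> ?p (i * N + k) = ((\<lambda>B. Mat i ** B) ^^ k) (mat 1) *v ?p (i * N)" for k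
  proof (induction k)
    case (Suc k)
    have "?p (i * N + Suc k) = Mat i *v ?p (i * N + k)"
      using step[of k] Suc.prems by (simp add: vec_eq_iff del: propagate.simps)
    also have "?p (i * N + k) = ((\<lambda>B. Mat i ** B) ^^ k) (mat 1) *v ?p (i * N)"
      using Suc by simp
    finally show ?case by (simp flip: matrix_vector_mul_assoc)
  qed simp
  \<comment> \<open>The last step of the block is split off because it alone also projects onto
    \<open>a (Suc i)\<close>.\<close>
  obtain k where k: "N = Suc k" using N gr0_implies_Suc by blast
  have "Suc i * N = Suc (i * N + k)" using k by simp
  then have "?p (Suc i * N) = ?p (Suc (i * N + k))" by (simp only:)
  also have "\<dots> = (\<chi> s. of_bool (s = a (Suc i)) * (((\<lambda>B. Mat i ** B) ^^ N) (mat 1) *v ?p (i * N)) $ s)"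
    using step[of k] inner[of k] k by (simp flip: matrix_vector_mul_assoc)
  also have "\<dots> = (\<chi> s. of_bool (s = a (Suc i)) * (?c * ((\<lambda>B. Mat i ** B) ^^ N) (mat 1) $ s $ a i))"
    unfolding Suc.IH by (simp add: matrix_vector_mult_scaleR matrix_vector_mult_basis column_def)
  also have "\<dots> = ((\<Prod>l<Suc i. ((\<lambda>B. Mat l ** B) ^^ N) (mat 1) $ a (Suc l) $ a l) * q $ a 0) *\<^sub>R axis (a (Suc i)) 1"
    by (auto simp: vec_eq_iff axis_def)
  finally show ?case .
qed

text \<open>The integrals with a Riemann sum in the exponent have two limits: as products of entries
  of matrix powers they tend to the right-hand side, and by dominated convergence to the left-hand
  side.\<close>

theorem Feynman_Kac_cylinder:
  fixes P :: "'n::finite path measure" and v p0 :: "real^'n"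
  assumes P: "is_stationary_P L p0 P" and grid: "time_grid j ts"
  shows "(\<integral>w. indicator (cylinder j ts a) w * exp (integral {0..ts j} (\<lambda>s. v $ w s)) \<partial>P)
    = chain_weight (\<lambda>s. matrix_exp (s *\<^sub>R (L + diag_matrix v))) p0 j ts a"
proof -
  interpret prob_space P using P by (simp add: is_stationary_P_def)
  have sets: "sets P = sets path_algebra"
    and meas: "time_grid r ts \<Longrightarrow> measure P (cylinder r ts a) = chain_weight (semigroup_P L) p0 r ts a" for r ts a
    using P by (auto simp: is_stationary_P_def)
  have space: "space P = paths" using sets_eq_imp_space_eq[OF sets] by simp
  define \<Delta> where "\<Delta> = (\<lambda>n i. (ts (Suc i) - ts i) / real (Suc n))"
  define S where "S n w = (\<Sum>m<j * Suc n. v $ w (refine_grid (Suc n) ts (Suc m)) * \<Delta> n (m div Suc n))" for n and w :: "'n path"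
  \<comment> \<open>The first factor pins the state at the coarse times, the multiples of
    \<open>Suc n\<close>. The second carries the potential over the step that ends at index m, hence
    the index \<open>m - 1\<close>; at \<open>m = 0\<close> no step has ended.\<close>
  define h where "h n m s = (if Suc n dvd m then of_bool (s = a (m div Suc n)) else 1) *
      (if m = 0 then 1 else exp (\<Delta> n ((m - 1) div Suc n) * v $ s))" for n m s
  define Mat where "Mat n i = diag_matrix (\<chi> s. exp (\<Delta> n i * v $ s)) ** semigroup_P L (\<Delta> n i)" for n i
  have prod: "(\<Prod>m\<le>j * Suc n. h n m (w (refine_grid (Suc n) ts m))) = indicator (cylinder j ts a) w * exp (S n w)"
    if w: "w \<in> paths" for n w
  proof -
    let ?N = "Suc n" and ?w = "\<lambda>m. w (refine_grid (Suc n) ts m)"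
    have "(\<Prod>m\<le>j * ?N. (if ?N dvd m then of_bool (?w m = a (m div ?N)) else (1::real))) = indicator (cylinder j ts a) w"
    proof (cases "w \<in> cylinder j ts a")
      case True
      have "?w m = a (m div ?N)" if m: "m \<le> j * ?N" "?N dvd m" for m
      proof -
        obtain i where i: "m = i * ?N" using m(2) by (metis dvd_div_mult_self)
        then have "i \<le> j" using m(1) by (simp only: mult_le_cancel2)
        then show ?thesis
          using True unfolding i by (simp add: refine_grid_mult cylinder_def del: mult_Suc_right)
      qed
      then show ?thesis using True by (intro trans[OF prod.neutral]) auto
    next
      case False
      then obtain i where i: "i \<le> j" "w (ts i) \<noteq> a i" using w by (auto simp: cylinder_def)
      have "(if ?N dvd i * ?N then of_bool (?w (i * ?N) = a (i * ?N div ?N)) else 1) = (0::real)"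
        using i(2) by (simp add: refine_grid_mult del: mult_Suc_right)
      moreover have "i * ?N \<in> {..j * ?N}" using i(1) by (simp del: mult_Suc_right)
      ultimately have "(\<Prod>m\<le>j * ?N. (if ?N dvd m then of_bool (?w m = a (m div ?N)) else (1::real))) = 0"
        by (intro prod_zero[OF finite_atMost] bexI)
      then show ?thesis using False by simp
    qed
    moreover have "(\<Prod>m\<le>j * ?N. (if m = 0 then 1 else exp (\<Delta> n ((m - 1) div ?N) * v $ ?w m))) = exp (S n w)"
      by (simp add: prod.atMost_shift exp_sum S_def mult.commute del: mult_Suc_right)
    ultimately show ?thesis by (simp only: h_def prod.distrib)
  qed
  have discrete: "(\<integral>w. indicator (cylinder j ts a) w * exp (S n w) \<partial>P)
      = (\<Prod>l<j. ((\<lambda>B. Mat n l ** B) ^^ Suc n) (mat 1) $ a (Suc l) $ a l) * p0 $ a 0" for n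
  proof -
    let ?r = "j * Suc n" and ?ts = "refine_grid (Suc n) ts"
    have g: "time_grid ?r ?ts" by (rule time_grid_refine[OF _ grid]) simp
    \<comment> \<open>With \<open>m = r\<close> only the last time remains fixed, and there h
      already demands the state \<open>a j\<close>, so the extra indicator does not alter the
      integral.\<close>
    have "(\<integral>w. (\<Prod>k\<le>?r. h n k (w (?ts k))) * indicator {w \<in> paths. \<forall>k\<in>{?r..?r}. w (?ts k) = a j} w \<partial>P)
        = propagate (semigroup_P L) p0 ?ts (h n) ?r $ a j"
      using discrete_path_expectation[OF _ sets g order_refl meas[OF g], of "h n" "\<lambda>_. a j"]
      by (simp add: finite_measure_axioms)
    moreover have "(\<integral>w. (\<Prod>k\<le>?r. h n k (w (?ts k))) * indicator {w \<in> paths. \<forall>k\<in>{?r..?r}. w (?ts k) = a j} w \<partial>P)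
        = (\<integral>w. indicator (cylinder j ts a) w * exp (S n w) \<partial>P)"
      by (intro Bochner_Integration.integral_cong refl)
         (auto simp: space prod refine_grid_mult cylinder_def simp del: mult_Suc_right split: split_indicator)
    moreover have "propagate (semigroup_P L) p0 ?ts (h n) ?r $ a j
        = (\<Prod>l<j. ((\<lambda>B. Mat n l ** B) ^^ Suc n) (mat 1) $ a (Suc l) $ a l) * p0 $ a 0"
      using propagate_block[of "Suc n" "semigroup_P L" p0 ts a v j]
      unfolding h_def[abs_def] Mat_def \<Delta>_def by simp
    ultimately show ?thesis by simp
  qed
  have "(\<lambda>n. \<integral>w. indicator (cylinder j ts a) w * exp (S n w) \<partial>P)
      \<longlonglongrightarrow> (\<Prod>l<j. matrix_exp ((ts (Suc l) - ts l) *\<^sub>R (L + diag_matrix v)) $ a (Suc l) $ a l) * p0 $ a 0"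
    unfolding discrete Mat_def \<Delta>_def semigroup_P_def
    by (intro tendsto_mult tendsto_prod tendsto_const matrix_exp_Trotter)
  moreover have "(\<lambda>n. \<integral>w. indicator (cylinder j ts a) w * exp (S n w) \<partial>P)
      \<longlonglongrightarrow> (\<integral>w. indicator (cylinder j ts a) w * exp (integral {0..ts j} (\<lambda>s. v $ w s)) \<partial>P)"
  proof (rule integral_dominated_convergence[where w = "\<lambda>_. exp (norm v * ts j)"])
    have S_lim: "(\<lambda>n. S n w) \<longlonglongrightarrow> integral {0..ts j} (\<lambda>s. v $ w s)" if "w \<in> paths" for w
      unfolding S_def \<Delta>_def by (rule refined_riemann_sum_tendsto[OF that grid])
    then show "AE w in P. (\<lambda>n. indicator (cylinder j ts a) w * exp (S n w)) \<longlonglongrightarrow>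
        indicator (cylinder j ts a) w * exp (integral {0..ts j} (\<lambda>s. v $ w s))"
      by (intro AE_I2 tendsto_intros) (simp add: space)
    have S_meas: "S n \<in> borel_measurable P" for n
    proof -
      have "(\<lambda>w. v $ w (refine_grid (Suc n) ts (Suc m))) \<in> borel_measurable P" if "m < j * Suc n" for m
      proof -
        have "0 \<le> refine_grid (Suc n) ts (Suc m)"
          using time_grid_nonneg[OF time_grid_refine[OF _ grid, of "Suc n"], of "Suc m"] that by simp
        from coordinate_measurable[OF this] show ?thesis
          unfolding measurable_cong_sets[OF sets refl] by (rule measurable_compose) simp
      qed
      then show ?thesis unfolding S_def by (intro borel_measurable_sum borel_measurable_times) auto
    qed
    have C_meas: "(indicator (cylinder j ts a) :: _ \<Rightarrow> real) \<in> borel_measurable P"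
      using cylinder_sets[OF grid, of a] sets by simp
    show "(\<lambda>w. indicator (cylinder j ts a) w * exp (S n w)) \<in> borel_measurable P" for n
      using S_meas[of n] C_meas by measurable
    have "(\<lambda>w. integral {0..ts j} (\<lambda>s. v $ w s)) \<in> borel_measurable P"
      by (rule borel_measurable_LIMSEQ_real[where u = S]) (simp_all add: space S_lim S_meas)
    then show "(\<lambda>w. indicator (cylinder j ts a) w * exp (integral {0..ts j} (\<lambda>s. v $ w s))) \<in> borel_measurable P"
      using C_meas by measurable
    \<comment> \<open>The step lengths telescope to \<open>ts j\<close>, which makes the bound
      uniform in n and supplies the dominating constant.\<close>
    have "S n w \<le> norm v * ts j" for n w
    proof -
      have \<Delta>_nonneg: "0 \<le> \<Delta> n (m div Suc n)" if "m < j * Suc n" for m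
      proof -
        have "m div Suc n < j" using that by (simp only: less_mult_imp_div_less)
        then show ?thesis using grid by (auto simp: time_grid_def \<Delta>_def less_imp_le)
      qed
      have "S n w \<le> (\<Sum>m<j * Suc n. norm v * \<Delta> n (m div Suc n))"
        unfolding S_def
        using component_le_norm_cart[of v] \<Delta>_nonneg
        by (intro sum_mono mult_right_mono) (auto intro: order_trans[OF abs_ge_self])
      also have "\<dots> = norm v * (\<Sum>m<j * Suc n. refine_grid (Suc n) ts (Suc m) - refine_grid (Suc n) ts m)"
        by (simp add: sum_distrib_left \<Delta>_def refine_grid_step del: mult_Suc_right)
      also have "\<dots> = norm v * ts j"
        unfolding sum_lessThan_telescope using grid by (simp add: refine_grid_mult time_grid_def refine_grid_def[of _ _ 0] del: mult_Suc_right)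
      finally show ?thesis .
    qed
    then show "AE w in P. norm (indicator (cylinder j ts a) w * exp (S n w)) \<le> exp (norm v * ts j)" for n
      by (intro AE_I2) (auto split: split_indicator)
  qed simp
  ultimately show ?thesis
    unfolding chain_weight_def by (rule LIMSEQ_unique[rotated])
qed

section \<open>The fibre measures\<close>

lemma chain_weight_Suc:
  "chain_weight K q (Suc r) ts a = K (ts (Suc r) - ts r) $ a (Suc r) $ a r * chain_weight K q r ts a"
  by (simp add: chain_weight_def)

lemma chain_weight_cong:
  assumes "\<And>k. k \<le> r \<Longrightarrow> ts k = ts' k" "\<And>k. k \<le> r \<Longrightarrow> a k = a' k"
  shows "chain_weight K q r ts a = chain_weight K q r ts' a'"
  unfolding chain_weight_def using assms by (intro arg_cong2[where f = "(*)"] prod.cong) auto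

lemma is_fiber_measure_cylinder:
  assumes "is_fiber_measure L p0 t x M"
    and "time_grid r ts" "1 \<le> j" "j \<le> r" "ts (j - 1) < t" "t \<le> ts j"
  shows "emeasure M (cylinder r ts a)
    = (if \<forall>k\<in>{j..r}. a k = x (ts k - t)
       then ennreal (1 / p0 $ x 0 * semigroup_P L (t - ts (j - 1)) $ x 0 $ a (j - 1)
                     * chain_weight (semigroup_P L) p0 (j - 1) ts a) else 0)"
  using assms unfolding is_fiber_measure_def by blast

lemma time_grid_two: "0 < t \<Longrightarrow> time_grid 1 (\<lambda>k. if k = 0 then 0 else t)"
  by (simp add: time_grid_def)

text \<open>Because \<open>t > 0\<close>, the index of \<open>t\<close> is not 0; it has a
  predecessor strictly before \<open>t\<close>, as the prescribed values of a fibre measure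
  require.\<close>

lemma ex_grid_through:
  assumes "0 < t" "finite F" "{0, t} \<subseteq> F" "F \<subseteq> {0..}"
  obtains r ts j where "time_grid r ts" "1 \<le> j" "j \<le> r" "ts j = t" "ts (j - 1) < t"
    "\<And>b :: real \<Rightarrow> 'n. path_cylinder F b = cylinder r ts (\<lambda>k. b (ts k))"
proof -
  obtain r ts where g: "time_grid r ts" and F: "ts ` {..r} = F"
    using ex_time_grid[of F] assms by auto
  then obtain j where j: "j \<le> r" "ts j = t" using assms(3) by auto
  have "j \<noteq> 0" using j assms(1) g by (auto simp: time_grid_def intro: gr0I)
  then have "1 \<le> j" "ts (j - 1) < t"
    using time_grid_strict_mono[OF g, of "j - 1" j] j by auto
  with g j F show ?thesis by (intro that[of r ts j]) (auto simp: cylinder_eq_path_cylinder)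
qed

locale stationary_chain =
  fixes L :: "real^'n^'n" and p0 :: "real^'n" and P :: "'n path measure"
  assumes positive: "positive_probability_vector p0"
    and L_p0: "L *v p0 = 0"
    and stationary: "is_stationary_P L p0 P"
begin

lemma p0_pos: "0 < p0 $ i"
  using positive by (simp add: positive_probability_vector_def)

lemma sets_P: "sets P = sets path_algebra"
  using stationary by (simp add: is_stationary_P_def)

lemma space_P: "space P = paths"
  using sets_eq_imp_space_eq[OF sets_P] by simp

lemma prob_space_P: "prob_space P"
  using stationary by (simp add: is_stationary_P_def)

lemma measure_P_cylinder: "time_grid r ts \<Longrightarrow> measure P (cylinder r ts a) = chain_weight (semigroup_P L) p0 r ts a"
  using stationary by (simp add: is_stationary_P_def)

text \<open>Summing over the state at time 0 gives component i of
  \<open>semigroup_P L t *v p0\<close>, and this vector is \<open>p0\<close> because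
  \<open>L *v p0 = 0\<close>. Hence \<open>1 / p0 $ x 0\<close> is the factor that normalises the
  event \<open>w t = x 0\<close>.\<close>

lemma measure_P_coordinate:
  assumes "0 < t"
  shows "measure P {w \<in> paths. w t = i} = p0 $ i"
proof -
  interpret prob_space P by (rule prob_space_P)
  let ?ts = "\<lambda>k :: nat. if k = 0 then 0 else t" and ?a = "\<lambda>b k. if k = (0 :: nat) then b else i"
  have grid: "time_grid 1 ?ts" by (rule time_grid_two[OF assms])
  have Un: "{w \<in> paths. w t = i} = (\<Union>b\<in>UNIV. cylinder 1 ?ts (?a b))"
    by (auto simp: cylinder_def le_Suc_eq)
  have "disjoint_family_on (\<lambda>b. cylinder 1 ?ts (?a b)) UNIV"
    by (auto simp: disjoint_family_on_def cylinder_def)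
  then have "measure P {w \<in> paths. w t = i} = (\<Sum>b\<in>UNIV. measure P (cylinder 1 ?ts (?a b)))"
    unfolding Un
    by (rule finite_measure_finite_Union[OF finite, rotated]) (use cylinder_sets[OF grid] in \<open>auto simp: sets_P\<close>)
  also have "\<dots> = (\<Sum>b\<in>UNIV. semigroup_P L t $ i $ b * p0 $ b)"
    by (simp add: measure_P_cylinder[OF grid] chain_weight_def del: One_nat_def)
  also have "\<dots> = (semigroup_P L t *v p0) $ i"
    by (simp add: matrix_vector_mult_def)
  also have "(t *\<^sub>R L) *v p0 = 0"
    using L_p0 by (simp add: scaleR_matrix_vector_assoc[symmetric])
  then have "semigroup_P L t *v p0 = p0"
    unfolding semigroup_P_def by (rule matrix_exp_fixes_kernel)
  finally show ?thesis .
qed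

text \<open>Conditionally on \<open>X\<^sub>t = x(0)\<close>, the past of a path under \<open>P\<close> has the law
  prescribed for the past under \<open>\<mu>\<^sub>t\<^sup>x\<close>; gluing \<open>x\<close> after it gives the fibre measure.\<close>

definition bridge :: "real \<Rightarrow> 'n path \<Rightarrow> 'n path measure" where
  "bridge t x = distr (density P (\<lambda>w. ennreal (indicator {w \<in> paths. w t = x 0} w / p0 $ x 0))) path_algebra (glue t x)"

lemma coordinate_set_P: "0 \<le> t \<Longrightarrow> {w \<in> paths. w t = i} \<in> sets P"
  by (auto simp: sets_P sets_path_algebra intro!: sigma_sets.Basic)

lemma sets_bridge [simp]: "sets (bridge t x) = sets path_algebra"
  by (simp add: bridge_def)

lemma space_bridge [simp]: "space (bridge t x) = paths"
  by (simp add: bridge_def)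

lemma nn_integral_bridge:
  assumes x: "x \<in> paths" and t: "0 < t" and h: "h \<in> borel_measurable path_algebra"
  shows "(\<integral>\<^sup>+w. h w \<partial>bridge t x)
    = (\<integral>\<^sup>+w. ennreal (indicator {w \<in> paths. w t = x 0} w / p0 $ x 0) * h (glue t x w) \<partial>P)"
proof -
  have glue: "glue t x \<in> measurable P path_algebra"
    using glue_measurable[OF x t] by (simp add: measurable_cong_sets[OF sets_P refl])
  have A: "(\<lambda>w. ennreal (indicator {w \<in> paths. w t = x 0} w / p0 $ x 0)) \<in> borel_measurable P"
    using coordinate_set_P[of t "x 0"] t by simp
  have hg: "(\<lambda>w. h (glue t x w)) \<in> borel_measurable P"
    by (rule measurable_compose[OF glue h])
  show ?thesis
    unfolding bridge_def using glue A hg h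
    by (subst nn_integral_distr) (simp_all add: nn_integral_density)
qed

lemma prob_space_bridge:
  assumes x: "x \<in> paths" and t: "0 < t"
  shows "prob_space (bridge t x)"
proof (rule prob_spaceI)
  interpret prob_space P by (rule prob_space_P)
  let ?A = "{w \<in> paths. w t = x 0}"
  have A: "?A \<in> sets P" using coordinate_set_P[of t "x 0"] t by simp
  have "emeasure (bridge t x) (space (bridge t x)) = (\<integral>\<^sup>+w. 1 \<partial>bridge t x)" by simp
  also have "\<dots> = (\<integral>\<^sup>+w. ennreal (indicator ?A w / p0 $ x 0) \<partial>P)"
    by (subst nn_integral_bridge[OF x t]) simp_all
  also have "\<dots> = (\<integral>\<^sup>+w. ennreal (1 / p0 $ x 0) * indicator ?A w \<partial>P)"
    by (intro nn_integral_cong) (simp split: split_indicator)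
  also have "\<dots> = ennreal (1 / p0 $ x 0) * ennreal (p0 $ x 0)"
    using A measure_P_coordinate[OF t, of "x 0"] by (simp add: nn_integral_cmult_indicator emeasure_eq_measure)
  also have "\<dots> = 1" using p0_pos[of "x 0"] by (simp flip: ennreal_mult'')
  finally show "emeasure (bridge t x) (space (bridge t x)) = 1" .
qed

text \<open>After gluing, the conditions from time \<open>t\<close> on concern the fixed path x
  alone, while the earlier ones together with \<open>w t = x 0\<close> form a cylinder to which the
  Feynman-Kac formula applies. The choice \<open>v = 0\<close> identifies the fibre measure; general
  v evaluates its weighted version.\<close>

lemma nn_integral_bridge_cylinder:
  fixes v :: "real^'n"
  defines "K \<equiv> \<lambda>s. matrix_exp (s *\<^sub>R (L + diag_matrix v))"
  assumes x: "x \<in> paths" and t: "0 < t" and grid: "time_grid r ts"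
    and j: "1 \<le> j" "j \<le> r" "ts (j - 1) < t" "t \<le> ts j"
  shows "(\<integral>\<^sup>+w. indicator (cylinder r ts a) w * ennreal (exp (integral {0..t} (\<lambda>s. v $ w s))) \<partial>bridge t x)
    = (if \<forall>k\<in>{j..r}. a k = x (ts k - t)
       then ennreal (1 / p0 $ x 0 * K (t - ts (j - 1)) $ x 0 $ a (j - 1) * chain_weight K p0 (j - 1) ts a) else 0)"
proof -
  interpret prob_space P by (rule prob_space_P)
  let ?A = "{w \<in> paths. w t = x 0}"
  let ?C = "\<forall>k\<in>{j..r}. a k = x (ts k - t)"
  let ?G = "\<lambda>w :: 'n path. exp (integral {0..t} (\<lambda>s. v $ w s))"
  \<comment> \<open>The past is observed up to \<open>t\<close> exactly, and its state there has to
    be \<open>x 0\<close>; the original time \<open>ts j\<close> may be later than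
    \<open>t\<close>.\<close>
  define ts' where "ts' = ts(j := t)"
  define a' where "a' = a(j := x 0)"
  have grid': "time_grid j ts'"
    unfolding time_grid_def ts'_def
  proof (intro conjI allI impI)
    show "(ts(j := t)) 0 = 0" using grid j by (simp add: time_grid_def)
    fix k assume "k < j"
    then consider "Suc k < j" | "k = j - 1" "Suc k = j" by linarith
    then show "(ts(j := t)) k < (ts(j := t)) (Suc k)"
      using grid j \<open>k < j\<close> by cases (auto simp: time_grid_def)
  qed
  have ts'_j: "ts' j = t" by (simp add: ts'_def)
  have G_meas: "?G \<in> borel_measurable path_algebra"
    using path_integral_measurable[OF t, of v] by measurable
  have pointwise: "ennreal (indicator ?A w / p0 $ x 0) * (indicator (cylinder r ts a) (glue t x w) * ennreal (?G (glue t x w)))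
      = (if ?C then ennreal (1 / p0 $ x 0 * (indicator (cylinder j ts' a') w * ?G w)) else 0)"
    if w: "w \<in> paths" for w
  proof (cases "w t = x 0")
    case True
    \<comment> \<open>The endpoint \<open>s = t\<close> is covered because \<open>w t = x 0\<close>
      in this case.\<close>
    have past: "glue t x w s = w s" if "s \<in> {0..t}" for s
      using that True by (auto simp: glue_def)
    have "integral {0..t} (\<lambda>s. v $ glue t x w s) = integral {0..t} (\<lambda>s. v $ w s)"
      by (rule integral_cong) (simp add: past)
    moreover have "glue t x w \<in> cylinder r ts a \<longleftrightarrow> ?C \<and> w \<in> cylinder j ts' a'"
    proof -
      have early: "glue t x w (ts k) = w (ts k)" if "k < j" for k
      proof -
        have "ts k \<le> ts (j - 1)" "0 \<le> ts k"
          using that j time_grid_mono[OF grid, of k "j - 1"] time_grid_nonneg[OF grid, of k] by auto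
        then show ?thesis using j by (intro past) auto
      qed
      have late: "glue t x w (ts k) = x (ts k - t)" if "j \<le> k" "k \<le> r" for k
      proof -
        have "t \<le> ts k" using that j time_grid_mono[OF grid, of j k] by auto
        then show ?thesis using t by (simp add: glue_def)
      qed
      have "glue t x w \<in> cylinder r ts a \<longleftrightarrow> (\<forall>k<j. w (ts k) = a k) \<and> ?C"
      proof
        assume "glue t x w \<in> cylinder r ts a"
        then show "(\<forall>k<j. w (ts k) = a k) \<and> ?C"
          using early late j by (auto simp: cylinder_def)
      next
        assume *: "(\<forall>k<j. w (ts k) = a k) \<and> ?C"
        have "glue t x w (ts k) = a k" if "k \<le> r" for k
          using * early[of k] late[of k] that by (cases "k < j") auto
        then show "glue t x w \<in> cylinder r ts a"
          using glue_paths[OF x w t] by (simp add: cylinder_def)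
      qed
      moreover have "w \<in> cylinder j ts' a' \<longleftrightarrow> (\<forall>k<j. w (ts k) = a k)"
        using w True by (auto simp: cylinder_def ts'_def a'_def le_less)
      ultimately show ?thesis by auto
    qed
    ultimately show ?thesis
      using True w p0_pos[of "x 0"] by (auto simp flip: ennreal_mult' split: split_indicator)
  next
    case False
    then have "w \<notin> cylinder j ts' a'" by (auto simp: cylinder_def ts'_def a'_def)
    with False show ?thesis by simp
  qed
  have FK_integrable: "integrable P (\<lambda>w. indicator (cylinder j ts' a') w * ?G w)"
  proof (rule integrable_const_bound)
    show "AE w in P. norm (indicator (cylinder j ts' a') w * ?G w) \<le> exp (norm v * t)"
    proof (rule AE_I2)
      fix w assume "w \<in> space P"
      then have "\<bar>integral {0..t} (\<lambda>s. v $ w s)\<bar> \<le> norm v * t"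
        using t by (intro path_integral_bound) (simp_all add: space_P)
      then show "norm (indicator (cylinder j ts' a') w * ?G w) \<le> exp (norm v * t)"
        by (auto split: split_indicator)
    qed
    have "cylinder j ts' a' \<in> sets P" using cylinder_sets[OF grid'] by (simp add: sets_P)
    moreover have "?G \<in> borel_measurable P"
      using G_meas by (simp only: measurable_cong_sets[OF sets_P refl])
    ultimately show "(\<lambda>w. indicator (cylinder j ts' a') w * ?G w) \<in> borel_measurable P"
      by measurable
  qed
  have "(\<integral>\<^sup>+w. indicator (cylinder r ts a) w * ennreal (?G w) \<partial>bridge t x)
      = (\<integral>\<^sup>+w. ennreal (indicator ?A w / p0 $ x 0) * (indicator (cylinder r ts a) (glue t x w) * ennreal (?G (glue t x w))) \<partial>P)"
    using cylinder_sets[OF grid, of a]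
    by (intro nn_integral_bridge[OF x t] borel_measurable_times_ennreal borel_measurable_indicator
        measurable_compose[OF G_meas measurable_ennreal])
  also have "\<dots> = (\<integral>\<^sup>+w. (if ?C then ennreal (1 / p0 $ x 0 * (indicator (cylinder j ts' a') w * ?G w)) else 0) \<partial>P)"
    by (intro nn_integral_cong pointwise) (simp add: space_P)
  also have "\<dots> = (if ?C then ennreal (1 / p0 $ x 0 * (\<integral>w. indicator (cylinder j ts' a') w * ?G w \<partial>P)) else 0)"
  proof (cases ?C)
    case True
    have "(\<integral>\<^sup>+w. ennreal (1 / p0 $ x 0 * (indicator (cylinder j ts' a') w * ?G w)) \<partial>P)
        = ennreal (\<integral>w. 1 / p0 $ x 0 * (indicator (cylinder j ts' a') w * ?G w) \<partial>P)"
      using p0_pos[of "x 0"]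
      by (intro nn_integral_eq_integral integrable_mult_right FK_integrable) simp
    then show ?thesis by (simp only: if_P[OF True] integral_mult_right_zero)
  next
    case False
    show ?thesis by (simp only: False if_False nn_integral_const mult_zero_left)
  qed
  also have "(\<integral>w. indicator (cylinder j ts' a') w * ?G w \<partial>P) = chain_weight K p0 j ts' a'"
    using Feynman_Kac_cylinder[OF stationary grid', of a' v] by (simp add: ts'_j K_def)
  also have "\<dots> = K (t - ts (j - 1)) $ x 0 $ a (j - 1) * chain_weight K p0 (j - 1) ts a"
  proof -
    obtain i where i: "j = Suc i" using j by (cases j) auto
    have "chain_weight K p0 i ts' a' = chain_weight K p0 i ts a"
      by (rule chain_weight_cong) (auto simp: ts'_def a'_def i)
    then show ?thesis unfolding i chain_weight_Suc by (simp add: ts'_def a'_def i)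
  qed
  finally show ?thesis by (simp only: mult.assoc)
qed

lemma semigroup_P_eq: "matrix_exp (s *\<^sub>R (L + diag_matrix 0)) = semigroup_P L s"
proof -
  have "diag_matrix (0 :: real^'n) = 0" by (simp add: diag_matrix_def vec_eq_iff)
  then show ?thesis by (simp add: semigroup_P_def)
qed

lemma emeasure_bridge_cylinder:
  assumes "x \<in> paths" "0 < t" "time_grid r ts" "1 \<le> j" "j \<le> r" "ts (j - 1) < t" "t \<le> ts j"
  shows "emeasure (bridge t x) (cylinder r ts a)
    = (if \<forall>k\<in>{j..r}. a k = x (ts k - t)
       then ennreal (1 / p0 $ x 0 * semigroup_P L (t - ts (j - 1)) $ x 0 $ a (j - 1)
                     * chain_weight (semigroup_P L) p0 (j - 1) ts a) else 0)"
  using nn_integral_bridge_cylinder[OF assms, of a 0] cylinder_sets[OF assms(3), of a]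
  by (simp add: semigroup_P_eq)

section \<open>Uniqueness of the fibre measure and its measurable dependence on the path\<close>

lemma is_fiber_measure_bridge:
  assumes x: "x \<in> paths" and t: "0 < t"
  shows "is_fiber_measure L p0 t x (bridge t x)"
  unfolding is_fiber_measure_def
proof (intro conjI allI impI)
  have glue: "glue t x \<in> measurable (density P (\<lambda>w. ennreal (indicator {w \<in> paths. w t = x 0} w / p0 $ x 0))) path_algebra"
    using glue_measurable[OF x t] by (simp add: measurable_cong_sets[OF sets_P refl])
  show "AE w in bridge t x. path_shift t w = x"
    unfolding bridge_def
    using shift_fiber_sets[OF x, of t] t path_shift_glue[OF x, of t]
    by (subst AE_distr_iff[OF glue]) simp_all
qed (use emeasure_bridge_cylinder[OF x t] in auto)

text \<open>The defining conditions determine the mass of every cylinder whose times contain 0 and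
  \<open>t\<close>, and these cylinders generate; this resolves the definite description.\<close>

lemma fiber_measure_eq_bridge:
  assumes x: "x \<in> paths" and t: "0 < t"
  shows "fiber_measure L p0 t x = bridge t x"
  unfolding fiber_measure_def
proof (rule the_equality)
  show "is_fiber_measure L p0 t x (bridge t x)" by (rule is_fiber_measure_bridge[OF assms])
  fix M assume M: "is_fiber_measure L p0 t x M"
  have cyl: "emeasure M (path_cylinder F b) = emeasure (bridge t x) (path_cylinder F b)"
    if F: "finite F" "{0, t} \<subseteq> F" "F \<subseteq> {0..}" for F b
  proof -
    obtain r ts j where g: "time_grid r ts" "1 \<le> j" "j \<le> r" "ts j = t" "ts (j - 1) < t"
      and F_eq: "path_cylinder F b = cylinder r ts (\<lambda>k. b (ts k))"
      by (rule ex_grid_through[OF t F]) blast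
    have "t \<le> ts j" using g by simp
    note cyl = is_fiber_measure_cylinder[OF _ g(1,2,3,5) this]
    show ?thesis
      unfolding F_eq cyl[OF M] cyl[OF is_fiber_measure_bridge[OF assms]] ..
  qed
  interpret prob_space "bridge t x" by (rule prob_space_bridge[OF assms])
  show "M = bridge t x"
    using t M by (intro measure_eq_on_cylinders_over[of "{0, t}"])
      (auto simp: is_fiber_measure_def cyl)
qed

text \<open>For a family of probability measures it suffices to test the generator. There the mass
  is a function of \<open>x 0\<close>, cut off by finitely many conditions on coordinates of x. The
  result allows the fibre measures to be integrated against \<rho>.\<close>

lemma bridge_measurable:
  assumes t: "0 < t"
  shows "bridge t \<in> measurable path_algebra (prob_algebra path_algebra)"
proof (rule measurable_prob_algebra_generated[OF sets_path_algebra_cylinders_over[of "{0, t}"]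
      Int_stable_cylinders_over])
  show "cylinders_over {0, t} \<subseteq> Pow (paths :: 'n path set)"
    by (auto simp: cylinders_over_def path_cylinder_def)
  fix A :: "'n path set" assume "A \<in> cylinders_over {0, t}"
  then consider "A = {}" | F b where "A = path_cylinder F b" "finite F" "{0, t} \<subseteq> F" "F \<subseteq> {0..}"
    unfolding cylinders_over_def by blast
  then show "(\<lambda>x. emeasure (bridge t x) A) \<in> borel_measurable path_algebra"
  proof cases
    case 1
    then show ?thesis by simp
  next
    case (2 F b)
    obtain r ts j where g: "time_grid r ts" "1 \<le> j" "j \<le> r" "ts j = t" "ts (j - 1) < t"
      and F_eq: "path_cylinder F b = cylinder r ts (\<lambda>k. b (ts k))"
      by (rule ex_grid_through[OF t 2(2-4)]) blast
    let ?H = "\<lambda>i. ennreal (1 / p0 $ i * semigroup_P L (t - ts (j - 1)) $ i $ b (ts (j - 1))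
                     * chain_weight (semigroup_P L) p0 (j - 1) ts (\<lambda>k. b (ts k)))"
    have "(\<lambda>x. emeasure (bridge t x) A) \<in> borel_measurable path_algebra \<longleftrightarrow>
      (\<lambda>x. if \<forall>k\<in>{j..r}. b (ts k) = x (ts k - t) then ?H (x 0) else 0) \<in> borel_measurable path_algebra"
      unfolding 2(1) F_eq using g
      by (intro measurable_cong) (simp add: emeasure_bridge_cylinder[OF _ t g(1,2,3,5)])
    also have "\<dots>"
    proof (rule measurable_If)
      show "(\<lambda>x. ?H (x 0)) \<in> borel_measurable path_algebra"
        by (rule measurable_compose[OF coordinate_measurable]) simp_all
      show "{x \<in> space path_algebra. \<forall>k\<in>{j..r}. b (ts k) = x (ts k - t)} \<in> sets path_algebra"
      proof (rule sets.sets_Collect_countable_All')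
        fix k assume "k \<in> {j..r}"
        then have "0 \<le> ts k - t" using time_grid_mono[OF g(1), of j k] g(4) by auto
        moreover have "{x \<in> space path_algebra. b (ts k) = x (ts k - t)} = {x \<in> paths. x (ts k - t) = b (ts k)}"
          by auto
        ultimately show "{x \<in> space path_algebra. b (ts k) = x (ts k - t)} \<in> sets path_algebra"
          by (auto simp: sets_path_algebra intro!: sigma_sets.Basic)
      qed simp
    qed simp
    finally show ?thesis .
  qed
qed (use t prob_space_bridge in auto)

end

section \<open>The eigenmeasure identity\<close>

lemma matrix_exp_eq_semigroup_V:
  "matrix_exp (s *\<^sub>R (L + diag_matrix v)) $ i $ k = exp (s * lam) * semigroup_V L v lam s $ i $ k"
proof -
  have "s *\<^sub>R (L + diag_matrix v - lam *\<^sub>R mat 1) = s *\<^sub>R (L + diag_matrix v) - (s * lam) *\<^sub>R mat 1"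
    by (simp add: scaleR_diff_right)
  then have "semigroup_V L v lam s = exp (- (s * lam)) *\<^sub>R matrix_exp (s *\<^sub>R (L + diag_matrix v))"
    unfolding semigroup_V_def by (simp only: matrix_exp_diff_scalar)
  then show ?thesis by (simp add: exp_minus)
qed

text \<open>The scalar factors of the single increments multiply to \<open>exp (ts j * lam)\<close>,
  since the increments telescope and \<open>ts 0 = 0\<close>.\<close>

lemma chain_weight_semigroup_V:
  assumes "time_grid j ts"
  shows "chain_weight (\<lambda>s. matrix_exp (s *\<^sub>R (L + diag_matrix v))) q j ts a
    = exp (ts j * lam) * chain_weight (semigroup_V L v lam) q j ts a"
proof -
  have "exp (ts j * lam) = (\<Prod>k<j. exp ((ts (Suc k) - ts k) * lam))"
  proof -
    have "(\<Sum>k<j. (ts (Suc k) - ts k) * lam) = ts j * lam"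
      unfolding sum_distrib_right[symmetric] sum_lessThan_telescope
      using assms by (simp add: time_grid_def)
    then show ?thesis by (simp flip: exp_sum)
  qed
  then show ?thesis
    by (simp add: chain_weight_def matrix_exp_eq_semigroup_V[of _ _ _ _ _ lam] prod.distrib)
qed

text \<open>The Markov property for weights: past and future meet in the state \<open>a j\<close>,
  and restarting the chain there counts \<open>p $ a j\<close> once more. Subtracting
  \<open>t\<close> leaves the increments unchanged.\<close>

lemma chain_weight_split:
  fixes a :: "nat \<Rightarrow> 'n::finite"
  assumes "j \<le> r"
  shows "chain_weight K p j ts a * chain_weight K p (r - j) (\<lambda>k. ts (k + j) - t) (\<lambda>k. a (k + j))
    = p $ a j * chain_weight K p r ts a"
proof -
  let ?g = "\<lambda>k. K (ts (Suc k) - ts k) $ a (Suc k) $ a k"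
  have "(\<Prod>k<r. ?g k) = (\<Prod>k<j. ?g k) * (\<Prod>k\<in>{j..<r}. ?g k)"
    using prod.atLeastLessThan_concat[of 0 j r ?g] assms by (simp add: atLeast0LessThan)
  also have "(\<Prod>k\<in>{j..<r}. ?g k) = (\<Prod>k<r - j. ?g (k + j))"
    using assms prod.shift_bounds_nat_ivl[of ?g 0 j "r - j"] by (simp add: atLeast0LessThan)
  finally show ?thesis by (simp add: chain_weight_def)
qed

context stationary_chain
begin

text \<open>The eigenvalue equation as an identity of measures:
  \<open>\<rho> \<bind> bridge t\<close> puts a random past of length \<open>t\<close> before a path
  drawn from \<rho>. On a cylinder through \<open>t\<close>, past and future separate and the claim
  reduces to \<open>chain_weight_split\<close>.\<close>

lemma density_bind_bridge:
  fixes z :: "'n \<Rightarrow> real" and v :: "real^'n"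
  assumes t: "0 < t" and \<rho>: "prob_space \<rho>" and sets_\<rho>: "sets \<rho> = sets path_algebra"
    and cyl: "\<And>r ts a. time_grid r ts \<Longrightarrow>
      measure \<rho> (cylinder r ts a) = z (a r) * chain_weight (semigroup_V L v lam) p0 r ts a"
  shows "density (\<rho> \<bind> bridge t) (\<lambda>w. ennreal (exp (integral {0..t} (\<lambda>s. v $ w s))))
    = density \<rho> (\<lambda>_. ennreal (exp (t * lam)))"
proof -
  interpret \<rho>: prob_space \<rho> by (rule \<rho>)
  let ?G = "\<lambda>w :: 'n path. exp (integral {0..t} (\<lambda>s. v $ w s))"
  let ?K = "\<lambda>s. matrix_exp (s *\<^sub>R (L + diag_matrix v))"
  have space_\<rho>: "space \<rho> = paths" using sets_eq_imp_space_eq[OF sets_\<rho>] by simp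
  have ne: "space \<rho> \<noteq> {}" by (rule \<rho>.not_empty)
  have kernel: "bridge t \<in> measurable \<rho> (subprob_algebra path_algebra)"
    using measurable_prob_algebraD[OF bridge_measurable[OF t]]
    by (simp only: measurable_cong_sets[OF sets_\<rho> refl])
  have sets_R: "sets (\<rho> \<bind> bridge t) = sets path_algebra"
    by (rule sets_bind[OF _ ne]) simp
  have G: "(\<lambda>w. ennreal (?G w)) \<in> borel_measurable path_algebra"
    using path_integral_measurable[OF t, of v] by measurable
  have emeasure_eq: "emeasure (density (\<rho> \<bind> bridge t) (\<lambda>w. ennreal (?G w))) (path_cylinder F b)
      = emeasure (density \<rho> (\<lambda>_. ennreal (exp (t * lam)))) (path_cylinder F b)"
    if F: "finite F" "{0, t} \<subseteq> F" "F \<subseteq> {0..}" for F b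
  proof -
    obtain r ts j where g: "time_grid r ts" "1 \<le> j" "j \<le> r" "ts j = t" "ts (j - 1) < t"
      and F_eq: "path_cylinder F b = cylinder r ts (\<lambda>k. b (ts k))"
      by (rule ex_grid_through[OF t F]) blast
    define a where "a = (\<lambda>k. b (ts k))"
    define ts' where "ts' = (\<lambda>k. ts (k + j) - t)"
    define a' where "a' = (\<lambda>k. a (k + j))"
    \<comment> \<open>The weighted mass of the past, given that it ends in \<open>a j\<close>. It
      does not depend on x, because \<open>x 0 = a j\<close> on the shifted cylinder.\<close>
    define c where "c = 1 / p0 $ a j * chain_weight ?K p0 j ts a"
    have grid_j: "time_grid j ts" using g by (auto simp: time_grid_def)
    have grid': "time_grid (r - j) ts'" using g by (auto simp: time_grid_def ts'_def)
    have C: "cylinder r ts a \<in> sets path_algebra" by (rule cylinder_sets[OF g(1)])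
    have C': "cylinder (r - j) ts' a' \<in> sets \<rho>" using cylinder_sets[OF grid'] by (simp add: sets_\<rho>)
    have c_nonneg: "0 \<le> c"
    proof -
      \<comment> \<open>The sign is taken from the integral representation, so that no discussion of
        the entries of the matrix exponential is required.\<close>
      have "0 \<le> chain_weight ?K p0 j ts a"
        unfolding Feynman_Kac_cylinder[OF stationary grid_j, symmetric]
        by (intro integral_nonneg_AE) simp
      then show ?thesis using p0_pos[of "a j"] by (simp add: c_def)
    qed
    have inner: "(\<integral>\<^sup>+w. ennreal (?G w) * indicator (cylinder r ts a) w \<partial>bridge t x)
        = ennreal c * indicator (cylinder (r - j) ts' a') x" if x: "x \<in> paths" for x
    proof -
      have "(\<integral>\<^sup>+w. ennreal (?G w) * indicator (cylinder r ts a) w \<partial>bridge t x)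
        = (if \<forall>k\<in>{j..r}. a k = x (ts k - t)
           then ennreal (1 / p0 $ x 0 * ?K (t - ts (j - 1)) $ x 0 $ a (j - 1) * chain_weight ?K p0 (j - 1) ts a) else 0)"
        using nn_integral_bridge_cylinder[OF x t g(1,2,3,5), of a v] g(4) by (simp add: mult.commute)
      moreover have "(\<forall>k\<in>{j..r}. a k = x (ts k - t)) \<longleftrightarrow> x \<in> cylinder (r - j) ts' a'"
      proof
        assume *: "\<forall>k\<in>{j..r}. a k = x (ts k - t)"
        show "x \<in> cylinder (r - j) ts' a'"
          using x * g(3) by (auto simp: cylinder_def ts'_def a'_def)
      next
        assume *: "x \<in> cylinder (r - j) ts' a'"
        show "\<forall>k\<in>{j..r}. a k = x (ts k - t)"
        proof
          fix k assume "k \<in> {j..r}"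
          then have "k - j \<le> r - j" "k - j + j = k" by auto
          with * show "a k = x (ts k - t)" by (auto simp: cylinder_def ts'_def a'_def)
        qed
      qed
      moreover have "1 / p0 $ x 0 * ?K (t - ts (j - 1)) $ x 0 $ a (j - 1) * chain_weight ?K p0 (j - 1) ts a = c"
        if "x \<in> cylinder (r - j) ts' a'"
      proof -
        have "x 0 = a j" using that g(4) by (auto simp: cylinder_def ts'_def a'_def dest!: spec[of _ 0])
        moreover obtain i where "j = Suc i" using g(2) by (cases j) auto
        ultimately show ?thesis using g(4) by (simp add: c_def chain_weight_Suc)
      qed
      ultimately show ?thesis by (simp split: split_indicator)
    qed
    have "emeasure (density (\<rho> \<bind> bridge t) (\<lambda>w. ennreal (?G w))) (cylinder r ts a)
        = (\<integral>\<^sup>+w. ennreal (?G w) * indicator (cylinder r ts a) w \<partial>(\<rho> \<bind> bridge t))"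
      using G C by (intro emeasure_density) (simp_all add: sets_R measurable_cong_sets[OF sets_R refl])
    also have "\<dots> = (\<integral>\<^sup>+x. \<integral>\<^sup>+w. ennreal (?G w) * indicator (cylinder r ts a) w \<partial>bridge t x \<partial>\<rho>)"
      using G C by (intro nn_integral_bind[OF _ kernel] borel_measurable_times_ennreal borel_measurable_indicator)
    also have "\<dots> = (\<integral>\<^sup>+x. ennreal c * indicator (cylinder (r - j) ts' a') x \<partial>\<rho>)"
      by (intro nn_integral_cong inner) (simp add: space_\<rho>)
    also have "\<dots> = ennreal c * ennreal (measure \<rho> (cylinder (r - j) ts' a'))"
      using C' by (simp add: nn_integral_cmult_indicator \<rho>.emeasure_eq_measure)
    also have "\<dots> = ennreal (c * measure \<rho> (cylinder (r - j) ts' a'))"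
      by (simp add: ennreal_mult'')
    also have "c * measure \<rho> (cylinder (r - j) ts' a') = exp (t * lam) * measure \<rho> (cylinder r ts a)"
    proof -
      let ?K' = "semigroup_V L v lam"
      \<comment> \<open>Only the past carries the unnormalised exponential, over the time
        \<open>ts j = t\<close>: this is the origin of \<open>exp (t * lam)\<close>. The shifted
        cylinder ends in the same state \<open>a r\<close>, so z takes the same value on both
        sides.\<close>
      have "c * measure \<rho> (cylinder (r - j) ts' a')
        = 1 / p0 $ a j * exp (t * lam) * z (a r) *
          (chain_weight ?K' p0 j ts a * chain_weight ?K' p0 (r - j) ts' a')"
        using g(3) unfolding c_def cyl[OF grid'] chain_weight_semigroup_V[OF grid_j, of L v p0 a lam] g(4)
        by (simp add: a'_def)
      also have "\<dots> = 1 / p0 $ a j * exp (t * lam) * z (a r) * (p0 $ a j * chain_weight ?K' p0 r ts a)"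
        unfolding ts'_def a'_def chain_weight_split[OF g(3)] ..
      also have "\<dots> = exp (t * lam) * measure \<rho> (cylinder r ts a)"
        using p0_pos[of "a j"] by (simp add: cyl[OF g(1)])
      finally show ?thesis .
    qed
    also have "ennreal (exp (t * lam) * measure \<rho> (cylinder r ts a))
        = emeasure (density \<rho> (\<lambda>_. ennreal (exp (t * lam)))) (cylinder r ts a)"
      using C by (simp add: emeasure_density_const sets_\<rho> \<rho>.emeasure_eq_measure ennreal_mult'')
    finally show ?thesis unfolding F_eq a_def .
  qed
  show ?thesis
  proof (rule measure_eq_on_cylinders_over[OF _ _ _ _ emeasure_eq])
    show "finite {0, t}" "{0, t} \<subseteq> {0..}" using t by simp_all
    show "sets (density (\<rho> \<bind> bridge t) (\<lambda>w. ennreal (?G w))) = sets path_algebra"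
      by (simp only: sets_density sets_R)
    show "sets (density \<rho> (\<lambda>_. ennreal (exp (t * lam)))) = sets path_algebra"
      by (simp only: sets_density sets_\<rho>)
    show "emeasure (density (\<rho> \<bind> bridge t) (\<lambda>w. ennreal (?G w))) (path_cylinder F b) \<noteq> \<infinity>"
      if F: "finite F" "{0, t} \<subseteq> F" "F \<subseteq> {0..}" for F b
      unfolding emeasure_eq[OF F] using path_cylinder_sets[OF F(1,3), of b]
      by (simp add: emeasure_density_const sets_\<rho> \<rho>.emeasure_eq_measure ennreal_mult_eq_top_iff)
  qed
qed

text \<open>The fibre carries the whole mass of its measure, so restricting the integral to it has
  no effect, and along a path \<open>V (path_shift s w)\<close> equals
  \<open>v $ w s\<close>.\<close>

lemma ruelle_V_eq_bridge_integral:
  assumes x: "x \<in> paths" and t: "0 < t" and V: "\<forall>w\<in>paths. V w = v $ w 0"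
    and f: "f \<in> borel_measurable path_algebra"
  shows "ruelle_V L p0 V t f x = (\<integral>w. exp (integral {0..t} (\<lambda>s. v $ w s)) * f w \<partial>bridge t x)"
proof -
  let ?A = "{w \<in> paths. path_shift t w = x}"
  have V_shift: "integral {0..t} (\<lambda>s. V (path_shift s w)) = integral {0..t} (\<lambda>s. v $ w s)"
    if "w \<in> paths" for w
  proof (rule integral_cong)
    fix s assume "s \<in> {0..t}"
    then have "path_shift s w \<in> paths" using that by (intro path_shift_paths) auto
    then have "V (path_shift s w) = v $ path_shift s w 0" using V by blast
    then show "V (path_shift s w) = v $ w s" by (simp add: path_shift_def)
  qed
  have A: "?A \<in> sets (bridge t x)"
    using shift_fiber_sets[OF x, of t] t by simp
  have G: "(\<lambda>w. exp (integral {0..t} (\<lambda>s. v $ w s)) * f w) \<in> borel_measurable (bridge t x)"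
    using path_integral_measurable[OF t, of v] f
    unfolding measurable_cong_sets[OF sets_bridge refl] by measurable
  have "AE w in bridge t x. path_shift t w = x"
    using is_fiber_measure_bridge[OF x t] by (simp add: is_fiber_measure_def)
  then have AE: "AE w in bridge t x. indicator ?A w *\<^sub>R (exp (integral {0..t} (\<lambda>s. v $ w s)) * f w)
      = exp (integral {0..t} (\<lambda>s. v $ w s)) * f w"
    by (rule AE_mp[OF _ AE_I2]) simp
  have "ruelle_V L p0 V t f x
    = (\<integral>w. indicator ?A w *\<^sub>R (exp (integral {0..t} (\<lambda>s. V (path_shift s w))) * f w) \<partial>bridge t x)"
    by (simp add: ruelle_V_def ruelle_def fiber_measure_eq_bridge[OF x t] set_lebesgue_integral_def)
  also have "\<dots> = (\<integral>w. indicator ?A w *\<^sub>R (exp (integral {0..t} (\<lambda>s. v $ w s)) * f w) \<partial>bridge t x)"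
    by (intro Bochner_Integration.integral_cong refl) (simp add: V_shift)
  also have "\<dots> = (\<integral>w. exp (integral {0..t} (\<lambda>s. v $ w s)) * f w \<partial>bridge t x)"
    using AE A G by (intro integral_cong_AE borel_measurable_scaleR borel_measurable_indicator)
  finally show ?thesis .
qed

text \<open>The identity of measures settles nonnegative functions; bounded ones follow by adding a
  constant, and functions that are bounded only almost everywhere by truncation.\<close>

lemma ruelle_V_eigenmeasure:
  fixes z :: "'n \<Rightarrow> real" and v :: "real^'n"
  assumes t: "0 < t" and \<rho>: "prob_space \<rho>" and sets_\<rho>: "sets \<rho> = sets path_algebra"
    and cyl: "\<And>r ts a. time_grid r ts \<Longrightarrow>
      measure \<rho> (cylinder r ts a) = z (a r) * chain_weight (semigroup_V L v lam) p0 r ts a"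
    and V: "\<forall>w\<in>paths. V w = v $ w 0" and f: "f \<in> Linf \<rho>"
  shows "(\<integral>x. ruelle_V L p0 V t f x \<partial>\<rho>) = exp (t * lam) * (\<integral>x. f x \<partial>\<rho>)"
proof -
  interpret \<rho>: prob_space \<rho> by (rule \<rho>)
  define G where "G w = exp (integral {0..t} (\<lambda>s. v $ w s))" for w :: "'n path"
  have space_\<rho>: "space \<rho> = paths" using sets_eq_imp_space_eq[OF sets_\<rho>] by simp
  have kernel: "bridge t \<in> measurable \<rho> (subprob_algebra path_algebra)"
    using measurable_prob_algebraD[OF bridge_measurable[OF t]]
    by (simp only: measurable_cong_sets[OF sets_\<rho> refl])
  have sets_R: "sets (\<rho> \<bind> bridge t) = sets path_algebra"
    by (rule sets_bind[OF _ \<rho>.not_empty]) simp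
  have G_meas: "G \<in> borel_measurable path_algebra"
    unfolding G_def using path_integral_measurable[OF t, of v] by measurable
  have G_pos: "0 < G w" for w by (simp add: G_def)
  have G_bound: "G w \<le> exp (norm v * t)" if "w \<in> paths" for w
    using path_integral_bound[OF that, of t v] t by (simp add: G_def)
  have nn: "(\<integral>\<^sup>+x. \<integral>\<^sup>+w. ennreal (G w) * h w \<partial>bridge t x \<partial>\<rho>) = ennreal (exp (t * lam)) * (\<integral>\<^sup>+x. h x \<partial>\<rho>)"
    if h: "h \<in> borel_measurable path_algebra" for h
  proof -
    have hR: "h \<in> borel_measurable (\<rho> \<bind> bridge t)" "(\<lambda>w. ennreal (G w)) \<in> borel_measurable (\<rho> \<bind> bridge t)"
      and h\<rho>: "h \<in> borel_measurable \<rho>"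
      using h G_meas by (simp_all add: measurable_cong_sets[OF sets_R refl] measurable_cong_sets[OF sets_\<rho> refl])
    have "(\<integral>\<^sup>+x. \<integral>\<^sup>+w. ennreal (G w) * h w \<partial>bridge t x \<partial>\<rho>) = (\<integral>\<^sup>+w. ennreal (G w) * h w \<partial>(\<rho> \<bind> bridge t))"
      using G_meas h by (intro nn_integral_bind[OF _ kernel, symmetric]) measurable
    also have "\<dots> = (\<integral>\<^sup>+w. h w \<partial>density (\<rho> \<bind> bridge t) (\<lambda>w. ennreal (G w)))"
      using hR by (intro nn_integral_density[symmetric])
    also have "density (\<rho> \<bind> bridge t) (\<lambda>w. ennreal (G w)) = density \<rho> (\<lambda>_. ennreal (exp (t * lam)))"
      unfolding G_def by (rule density_bind_bridge[OF t \<rho> sets_\<rho> cyl])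
    also have "(\<integral>\<^sup>+w. h w \<partial>density \<rho> (\<lambda>_. ennreal (exp (t * lam)))) = ennreal (exp (t * lam)) * (\<integral>\<^sup>+x. h x \<partial>\<rho>)"
      using h\<rho> by (subst nn_integral_density) (simp_all add: nn_integral_cmult)
    finally show ?thesis .
  qed
  have I_meas: "(\<lambda>x. \<integral>w. G w * h w \<partial>bridge t x) \<in> borel_measurable \<rho>"
    if "h \<in> borel_measurable path_algebra" for h :: "'n path \<Rightarrow> real"
    using that G_meas by (intro measurable_compose[OF kernel integral_measurable_subprob_algebra]) measurable
  have bridge_integrable: "integrable (bridge t x) (\<lambda>w. G w * h w)"
    if x: "x \<in> paths" and h: "h \<in> borel_measurable path_algebra" "\<And>w. \<bar>h w\<bar> \<le> B" for x B and h :: "'n path \<Rightarrow> real"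
  proof -
    interpret prob_space "bridge t x" by (rule prob_space_bridge[OF x t])
    show ?thesis
    proof (rule integrable_const_bound)
      have "norm (G w * h w) \<le> exp (norm v * t) * B" if "w \<in> paths" for w
        unfolding norm_mult using G_bound[OF that] G_pos[of w] h(2)[of w]
        by (intro mult_mono) (simp_all add: less_imp_le)
      then show "AE w in bridge t x. norm (G w * h w) \<le> exp (norm v * t) * B"
        by (intro AE_I2) simp
      show "(\<lambda>w. G w * h w) \<in> borel_measurable (bridge t x)"
        using G_meas h(1) unfolding measurable_cong_sets[OF sets_bridge refl] by measurable
    qed
  qed
  have nonneg: "(\<integral>x. \<integral>w. G w * h w \<partial>bridge t x \<partial>\<rho>) = exp (t * lam) * (\<integral>x. h x \<partial>\<rho>)"
      "integrable \<rho> (\<lambda>x. \<integral>w. G w * h w \<partial>bridge t x)" "integrable \<rho> h"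
    if h: "h \<in> borel_measurable path_algebra" "\<And>w. \<bar>h w\<bar> \<le> B" "\<And>w. 0 \<le> h w" for B and h :: "'n path \<Rightarrow> real"
  proof -
    have h\<rho>: "h \<in> borel_measurable \<rho>"
      using h by (simp add: measurable_cong_sets[OF sets_\<rho> refl])
    then show int_h: "integrable \<rho> h"
      using h(2) by (intro \<rho>.integrable_const_bound[of _ B]) auto
    have I_nonneg: "0 \<le> (\<integral>w. G w * h w \<partial>bridge t x)" for x
      using G_pos h(3) by (intro integral_nonneg_AE) (simp add: less_imp_le)
    have "(\<integral>\<^sup>+x. ennreal (\<integral>w. G w * h w \<partial>bridge t x) \<partial>\<rho>) = (\<integral>\<^sup>+x. \<integral>\<^sup>+w. ennreal (G w) * ennreal (h w) \<partial>bridge t x \<partial>\<rho>)"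
    proof (rule nn_integral_cong)
      fix x assume "x \<in> space \<rho>"
      then have "integrable (bridge t x) (\<lambda>w. G w * h w)"
        by (intro bridge_integrable[OF _ h(1,2)]) (simp add: space_\<rho>)
      then have "(\<integral>\<^sup>+w. ennreal (G w * h w) \<partial>bridge t x) = ennreal (\<integral>w. G w * h w \<partial>bridge t x)"
        using G_pos h(3) by (intro nn_integral_eq_integral) (simp_all add: less_imp_le)
      then show "ennreal (\<integral>w. G w * h w \<partial>bridge t x) = (\<integral>\<^sup>+w. ennreal (G w) * ennreal (h w) \<partial>bridge t x)"
        using h(3) by (simp add: ennreal_mult'')
    qed
    also have "\<dots> = ennreal (exp (t * lam)) * (\<integral>\<^sup>+x. ennreal (h x) \<partial>\<rho>)"
      using h(1) by (intro nn) measurable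
    also have "(\<integral>\<^sup>+x. ennreal (h x) \<partial>\<rho>) = ennreal (\<integral>x. h x \<partial>\<rho>)"
      using int_h h(3) by (intro nn_integral_eq_integral) simp_all
    finally have *: "(\<integral>\<^sup>+x. ennreal (\<integral>w. G w * h w \<partial>bridge t x) \<partial>\<rho>) = ennreal (exp (t * lam) * (\<integral>x. h x \<partial>\<rho>))"
      by (simp add: ennreal_mult')
    show "integrable \<rho> (\<lambda>x. \<integral>w. G w * h w \<partial>bridge t x)"
      using * I_nonneg by (intro integrableI_nonneg I_meas h(1)) simp_all
    have "0 \<le> exp (t * lam) * (\<integral>x. h x \<partial>\<rho>)"
      using h(3) by (intro mult_nonneg_nonneg integral_nonneg_AE) simp_all
    then show "(\<integral>x. \<integral>w. G w * h w \<partial>bridge t x \<partial>\<rho>) = exp (t * lam) * (\<integral>x. h x \<partial>\<rho>)"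
      using I_nonneg I_meas[OF h(1)] by (subst integral_eq_nn_integral) (simp_all add: *)
  qed
  obtain C where f_meas: "f \<in> borel_measurable path_algebra" and C: "AE w in \<rho>. \<bar>f w\<bar> \<le> C"
    using f by (auto simp: Linf_def measurable_cong_sets[OF sets_\<rho> refl])
  \<comment> \<open>The maximum with 0 makes \<open>[-D, D]\<close> nonempty, so the truncation h is
    bounded everywhere and not just almost everywhere.\<close>
  define D where "D = max C 0"
  define h where "h w = max (- D) (min D (f w))" for w
  have h_meas: "h \<in> borel_measurable path_algebra"
    unfolding h_def using f_meas by measurable
  have h_bound: "\<bar>h w\<bar> \<le> D" for w by (simp add: h_def D_def)
  have hf: "AE w in \<rho>. f w = h w"
    using C by (rule AE_mp[OF _ AE_I2]) (auto simp: h_def D_def)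
  have f\<rho>: "f \<in> borel_measurable \<rho>" "h \<in> borel_measurable \<rho>"
    using f_meas h_meas by (simp_all add: measurable_cong_sets[OF sets_\<rho> refl])
  \<comment> \<open>Replacing f by h inside the fibre integrals requires that almost every fibre
    measure ignores the set where they differ, although that set is known to be null for \<rho>
    only.\<close>
  have hf_bridge: "AE x in \<rho>. AE w in bridge t x. f w = h w"
  proof -
    let ?N = "{w \<in> space path_algebra. f w \<noteq> h w}"
    have N: "?N \<in> sets path_algebra" using f_meas h_meas by (rule borel_measurable_neq)
    have ind: "(indicator ?N :: _ \<Rightarrow> ennreal) \<in> borel_measurable path_algebra" using N by simp
    have G_ind: "(\<lambda>w. ennreal (G w) * indicator ?N w) \<in> borel_measurable path_algebra"
      by (intro borel_measurable_times_ennreal measurable_compose[OF G_meas measurable_ennreal] ind)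
    have "(\<integral>\<^sup>+x. indicator ?N x \<partial>\<rho>) = 0"
    proof (subst nn_integral_0_iff_AE)
      show "(indicator ?N :: _ \<Rightarrow> ennreal) \<in> borel_measurable \<rho>"
        using ind by (simp only: measurable_cong_sets[OF sets_\<rho> refl])
      show "AE x in \<rho>. indicator ?N x = (0 :: ennreal)"
        using hf by (rule AE_mp[OF _ AE_I2]) simp
    qed
    then have "(\<integral>\<^sup>+x. \<integral>\<^sup>+w. ennreal (G w) * indicator ?N w \<partial>bridge t x \<partial>\<rho>) = 0"
      unfolding nn[OF ind] by simp
    moreover have "(\<lambda>x. \<integral>\<^sup>+w. ennreal (G w) * indicator ?N w \<partial>bridge t x) \<in> borel_measurable \<rho>"
      by (intro measurable_compose[OF kernel nn_integral_measurable_subprob_algebra] G_ind)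
    ultimately have "AE x in \<rho>. (\<integral>\<^sup>+w. ennreal (G w) * indicator ?N w \<partial>bridge t x) = 0"
      by (subst (asm) nn_integral_0_iff_AE)
    then show ?thesis
    proof (rule AE_mp[OF _ AE_I2], intro impI)
      fix x assume "(\<integral>\<^sup>+w. ennreal (G w) * indicator ?N w \<partial>bridge t x) = 0"
      moreover have "(\<lambda>w. ennreal (G w) * indicator ?N w) \<in> borel_measurable (bridge t x)"
        using G_ind by (simp only: measurable_cong_sets[OF sets_bridge refl])
      ultimately have "AE w in bridge t x. ennreal (G w) * indicator ?N w = 0"
        by (subst (asm) nn_integral_0_iff_AE)
      then show "AE w in bridge t x. f w = h w"
      proof (rule AE_mp[OF _ AE_I2], intro impI)
        fix w assume "w \<in> space (bridge t x)" "ennreal (G w) * indicator ?N w = 0"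
        then show "f w = h w" using G_pos[of w] by (auto simp: ennreal_eq_0_iff split: split_indicator_asm)
      qed
    qed
  qed
  have "(\<integral>x. ruelle_V L p0 V t f x \<partial>\<rho>) = (\<integral>x. \<integral>w. G w * f w \<partial>bridge t x \<partial>\<rho>)"
    by (intro Bochner_Integration.integral_cong refl)
       (simp add: ruelle_V_eq_bridge_integral[OF _ t V f_meas] G_def space_\<rho>)
  also have "\<dots> = (\<integral>x. \<integral>w. G w * h w \<partial>bridge t x \<partial>\<rho>)"
  proof (intro integral_cong_AE I_meas f_meas h_meas)
    show "AE x in \<rho>. (\<integral>w. G w * f w \<partial>bridge t x) = (\<integral>w. G w * h w \<partial>bridge t x)"
      using hf_bridge
    proof (rule AE_mp[OF _ AE_I2], intro impI)
      fix x assume "AE w in bridge t x. f w = h w"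
      then have "AE w in bridge t x. G w * f w = G w * h w" by (rule AE_mp[OF _ AE_I2]) simp
      then show "(\<integral>w. G w * f w \<partial>bridge t x) = (\<integral>w. G w * h w \<partial>bridge t x)"
        using G_meas f_meas h_meas
        by (intro integral_cong_AE borel_measurable_times) (simp_all add: measurable_cong_sets[OF sets_bridge refl])
    qed
  qed
  \<comment> \<open>Both \<open>h + D\<close> and the constant D are nonnegative and bounded, so the
    nonnegative case applies to each.\<close>
  also have "\<dots> = (\<integral>x. (\<integral>w. G w * (h w + D) \<partial>bridge t x) - (\<integral>w. G w * D \<partial>bridge t x) \<partial>\<rho>)"
  proof (intro Bochner_Integration.integral_cong refl)
    fix x assume "x \<in> space \<rho>"
    then have x: "x \<in> paths" by (simp add: space_\<rho>)
    have "integrable (bridge t x) (\<lambda>w. G w * h w)" by (rule bridge_integrable[OF x h_meas h_bound])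
    moreover have "integrable (bridge t x) (\<lambda>w. G w * D)" by (rule bridge_integrable[OF x, of _ "\<bar>D\<bar>"]) simp_all
    ultimately show "(\<integral>w. G w * h w \<partial>bridge t x) = (\<integral>w. G w * (h w + D) \<partial>bridge t x) - (\<integral>w. G w * D \<partial>bridge t x)"
      unfolding distrib_left by (subst Bochner_Integration.integral_add) simp_all
  qed
  also have "\<dots> = exp (t * lam) * (\<integral>x. h x + D \<partial>\<rho>) - exp (t * lam) * (\<integral>x. D \<partial>\<rho>)"
  proof -
    have D0: "0 \<le> D" by (simp add: D_def)
    have hD: "(\<lambda>w. h w + D) \<in> borel_measurable path_algebra" using h_meas by measurable
    have hD_bound: "\<bar>h w + D\<bar> \<le> 2 * D" "0 \<le> h w + D" for w using h_bound[of w] by linarith+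
    have Dc: "(\<lambda>_. D) \<in> borel_measurable path_algebra" "\<bar>D\<bar> \<le> D" using D0 by simp_all
    show ?thesis
      using nonneg[OF hD hD_bound] nonneg[OF Dc(1) Dc(2) D0]
      by (subst Bochner_Integration.integral_diff) simp_all
  qed
  also have "\<dots> = exp (t * lam) * (\<integral>x. h x \<partial>\<rho>)"
  proof -
    have "integrable \<rho> h" using f\<rho> h_bound by (intro \<rho>.integrable_const_bound[of _ D]) auto
    then show ?thesis by (simp add: \<rho>.prob_space algebra_simps)
  qed
  also have "(\<integral>x. h x \<partial>\<rho>) = (\<integral>x. f x \<partial>\<rho>)"
    using hf f\<rho> by (intro integral_cong_AE) (auto elim: eventually_mono)
  finally show ?thesis .
qed

end

section \<open>The measure \<open>\<rho>\<^sub>V\<close>\<close>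

text \<open>For \<open>c \<le> 0\<close> the density \<open>1 / g_V\<close> is nowhere positive (at
  \<open>c = 0\<close> by division by zero), so \<open>ennreal\<close> sends it to 0 and \<rho>
  would be the zero measure.\<close>

lemma rho_V_normalisation_pos:
  assumes "prob_space (rho_V p0 \<mu> c \<nu>)" "\<And>i. 0 < p0 $ i" "\<And>i. 0 < \<mu> $ i"
  shows "0 < c"
proof (rule ccontr)
  assume "\<not> 0 < c"
  then have "g_V p0 \<mu> c w \<le> 0" for w
    unfolding g_V_def using assms(2,3)[of "w 0"] by (intro mult_nonpos_nonneg) simp_all
  then have "rho_V p0 \<mu> c \<nu> = density \<nu> (\<lambda>_. 0)"
    unfolding rho_V_def by (intro arg_cong[where f = "density \<nu>"] ext) (simp add: ennreal_neg)
  then have "emeasure (rho_V p0 \<mu> c \<nu>) (space (rho_V p0 \<mu> c \<nu>)) = 0"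
    by (simp add: emeasure_density)
  then show False using prob_space.emeasure_space_1[OF assms(1)] by simp
qed

text \<open>On a cylinder the state at time 0 is \<open>a 0\<close>, so the density is constant
  there. It exchanges the initial weight \<mu> for \<open>p0\<close> and leaves the transitions
  untouched; c goes into the terminal weight.\<close>

lemma measure_rho_V_cylinder:
  fixes \<nu> :: "'n::finite path measure" and \<mu> p0 :: "real^'n"
  assumes \<nu>: "prob_space \<nu>" "sets \<nu> = sets path_algebra" and c: "0 < c"
    and p0: "\<And>i. 0 < p0 $ i" and \<mu>: "\<And>i. 0 < \<mu> $ i" and grid: "time_grid r ts"
    and cyl: "measure \<nu> (cylinder r ts a) = z * chain_weight K \<mu> r ts a"
  shows "measure (rho_V p0 \<mu> c \<nu>) (cylinder r ts a) = z / c * chain_weight K p0 r ts a"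
proof -
  interpret prob_space \<nu> by (rule \<nu>(1))
  let ?g = "1 / (c * (\<mu> $ a 0 / p0 $ a 0))"
  have g: "0 \<le> ?g" using c p0[of "a 0"] \<mu>[of "a 0"] by simp
  have C: "cylinder r ts a \<in> sets \<nu>" using cylinder_sets[OF grid] by (simp add: \<nu>(2))
  have "(\<lambda>w. ennreal (1 / g_V p0 \<mu> c w)) \<in> borel_measurable \<nu>"
    unfolding measurable_cong_sets[OF \<nu>(2) refl] g_V_def
    by (rule measurable_compose[OF coordinate_measurable]) simp_all
  then have "emeasure (rho_V p0 \<mu> c \<nu>) (cylinder r ts a)
      = (\<integral>\<^sup>+w. ennreal (1 / g_V p0 \<mu> c w) * indicator (cylinder r ts a) w \<partial>\<nu>)"
    unfolding rho_V_def using C by (rule emeasure_density)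
  also have "\<dots> = (\<integral>\<^sup>+w. ennreal ?g * indicator (cylinder r ts a) w \<partial>\<nu>)"
    using grid by (intro nn_integral_cong)
      (auto simp: g_V_def cylinder_def time_grid_def dest: spec[of _ 0] split: split_indicator)
  also have "\<dots> = ennreal (?g * measure \<nu> (cylinder r ts a))"
    using C by (simp only: nn_integral_cmult_indicator emeasure_eq_measure ennreal_mult'[OF g])
  finally have "measure (rho_V p0 \<mu> c \<nu>) (cylinder r ts a) = ?g * measure \<nu> (cylinder r ts a)"
    by (rule measure_eq_emeasure_eq_ennreal[OF mult_nonneg_nonneg[OF g measure_nonneg]])
  also have "\<dots> = z / c * chain_weight K p0 r ts a"
    using c p0[of "a 0"] \<mu>[of "a 0"] by (simp add: cyl chain_weight_def field_simps)
  finally show ?thesis .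
qed

lemma sets_rho_V: "sets (rho_V p0 \<mu> c \<nu>) = sets \<nu>"
  by (simp add: rho_V_def)

text \<open>Summing the cylinder values over the last state shows that the columns of
  \<open>exp (s (L + V - lam))\<close> sum to 1; differentiating in \<open>s\<close> gives \<open>V = lam\<close>.\<close>

lemma is_nu_V_imp_constant:
  fixes L :: "real^'n^'n"
  assumes L: "is_generator L" and \<nu>: "is_nu_V L v lam \<mu> \<nu>" and \<mu>: "\<And>i. 0 < \<mu> $ i"
  shows "v $ i = lam"
proof -
  have \<nu>_sets: "sets \<nu> = sets path_algebra"
    and cyl: "time_grid r ts \<Longrightarrow> measure \<nu> (cylinder r ts a) = chain_weight (semigroup_V L v lam) \<mu> r ts a" for r ts a
    using \<nu> by (auto simp: is_nu_V_def)
  interpret prob_space \<nu> using \<nu> by (simp add: is_nu_V_def)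
  have sums: "(\<Sum>k\<in>UNIV. semigroup_V L v lam s $ k $ j) = 1" if s: "0 < s" for s j
  proof -
    let ?ts = "\<lambda>k :: nat. if k = 0 then 0 else s" and ?a = "\<lambda>b k. if k = (0 :: nat) then j else b"
    have grid: "time_grid 1 ?ts" by (rule time_grid_two[OF s])
    have grid0: "time_grid 0 (\<lambda>_. 0)" by (simp add: time_grid_def)
    have Un: "cylinder 0 (\<lambda>_. 0) (\<lambda>_. j) = (\<Union>b\<in>UNIV. cylinder 1 ?ts (?a b))"
      by (auto simp: cylinder_def le_Suc_eq)
    have "disjoint_family_on (\<lambda>b. cylinder 1 ?ts (?a b)) UNIV"
      by (auto simp: disjoint_family_on_def cylinder_def)
    then have "measure \<nu> (cylinder 0 (\<lambda>_. 0) (\<lambda>_. j)) = (\<Sum>b\<in>UNIV. measure \<nu> (cylinder 1 ?ts (?a b)))"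
      unfolding Un
      by (rule finite_measure_finite_Union[OF finite, rotated]) (use cylinder_sets[OF grid] in \<open>auto simp: \<nu>_sets\<close>)
    then have "\<mu> $ j = (\<Sum>k\<in>UNIV. semigroup_V L v lam s $ k $ j) * \<mu> $ j"
      unfolding cyl[OF grid] cyl[OF grid0] by (simp add: chain_weight_def sum_distrib_right)
    then show ?thesis using \<mu>[of j] by simp
  qed
  have "(\<Sum>k\<in>UNIV. (L + diag_matrix v - lam *\<^sub>R mat 1) $ k $ i) = 0"
    by (rule column_sums_zero_if_matrix_exp_stochastic) (use sums in \<open>simp add: semigroup_V_def\<close>)
  moreover have "(\<Sum>k\<in>UNIV. L $ k $ i) = 0" using L by (simp add: is_generator_def)
  moreover have "(\<Sum>k\<in>UNIV. (L + diag_matrix v - lam *\<^sub>R mat 1) $ k $ i)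
      = (\<Sum>k\<in>UNIV. L $ k $ i) + (\<Sum>k\<in>UNIV. if k = i then v $ i - lam else 0)"
    unfolding sum.distrib[symmetric] by (intro sum.cong) (auto simp: diag_matrix_def mat_def)
  ultimately show ?thesis by simp
qed

context stationary_chain
begin

text \<open>Here V is the constant \<open>lam\<close>, so \<open>semigroup_V\<close> is the
  semigroup of P and \<rho> is \<open>1 / c\<close> times P. Essential boundedness therefore passes
  from P to \<rho>.\<close>

lemma Linf_rho_V_if_is_nu_V:
  assumes L: "is_generator L" and \<nu>: "is_nu_V L v lam \<mu> \<nu>" and \<mu>: "\<And>i. 0 < \<mu> $ i"
    and \<rho>: "prob_space (rho_V p0 \<mu> c \<nu>)" and f: "f \<in> Linf P"
  shows "f \<in> Linf (rho_V p0 \<mu> c \<nu>)"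
proof -
  let ?\<rho> = "rho_V p0 \<mu> c \<nu>"
  interpret \<rho>: prob_space ?\<rho> by (rule \<rho>)
  interpret P: prob_space P by (rule prob_space_P)
  have c: "0 < c" by (rule rho_V_normalisation_pos[OF \<rho> p0_pos \<mu>])
  have sets_\<rho>: "sets ?\<rho> = sets path_algebra" using \<nu> by (simp add: sets_rho_V is_nu_V_def)
  have "diag_matrix v = lam *\<^sub>R mat 1"
    using is_nu_V_imp_constant[OF L \<nu> \<mu>] by (simp add: diag_matrix_def mat_def vec_eq_iff)
  then have K: "semigroup_V L v lam = semigroup_P L"
    by (intro ext) (simp add: semigroup_V_def semigroup_P_def)
  have cyl: "measure ?\<rho> (cylinder r ts a) = 1 / c * measure P (cylinder r ts a)" if "time_grid r ts" for r ts a
    unfolding measure_P_cylinder[OF that] K[symmetric]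
    using \<nu> that by (intro measure_rho_V_cylinder[OF _ _ c p0_pos \<mu>]) (auto simp: is_nu_V_def)
  have density: "?\<rho> = density P (\<lambda>_. ennreal (1 / c))"
  proof (rule measure_eq_on_cylinders_over)
    show "finite {0 :: real}" "{0 :: real} \<subseteq> {0..}" by simp_all
    show "emeasure ?\<rho> (path_cylinder F b) = emeasure (density P (\<lambda>_. ennreal (1 / c))) (path_cylinder F b)"
      if F: "finite F" "{0} \<subseteq> F" "F \<subseteq> {0..}" for F b
    proof -
      obtain r ts where g: "time_grid r ts" "ts ` {..r} = F" using ex_time_grid[of F] F by auto
      have F_eq: "path_cylinder F b = cylinder r ts (\<lambda>k. b (ts k))"
        unfolding g(2)[symmetric] by (rule cylinder_eq_path_cylinder)
      have C: "cylinder r ts (\<lambda>k. b (ts k)) \<in> sets P" using cylinder_sets[OF g(1)] by (simp only: sets_P)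
      have "emeasure ?\<rho> (cylinder r ts (\<lambda>k. b (ts k))) = ennreal (1 / c) * emeasure P (cylinder r ts (\<lambda>k. b (ts k)))"
        unfolding \<rho>.emeasure_eq_measure P.emeasure_eq_measure cyl[OF g(1)]
        using c by (intro ennreal_mult') simp
      then show ?thesis
        unfolding F_eq by (simp only: emeasure_density_const[OF C])
    qed
    show "emeasure ?\<rho> (path_cylinder F b) \<noteq> \<infinity>" for F b by simp
  qed (simp_all only: sets_density sets_P sets_\<rho>)
  have "AE w in ?\<rho>. Q w" if "AE w in P. Q w" for Q
    unfolding density using that by (subst AE_density) (auto elim: eventually_mono)
  then show ?thesis
    using f by (auto simp: Linf_def measurable_cong_sets[OF sets_\<rho> refl] measurable_cong_sets[OF sets_P refl])
qed

end

text \<open>Both parts come from one eigenmeasure identity, with terminal weight 1 and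
  \<open>u\<close>. A measure with weight \<open>u\<close> need not be absolutely continuous with
  respect to P, so in the second part f is essentially bounded for both measures.\<close>

theorem mainTheorem4:
  fixes L :: "real^'n^'n" and p0 v u \<mu> :: "real^'n" and P :: "'n path measure"
    and V :: "'n path \<Rightarrow> real" and lam t :: real
  assumes "is_generator L"
    and "positive_probability_vector p0" and "L *v p0 = 0"
    and "is_stationary_P L p0 P"
    and "\<forall>w\<in>paths. V w = v $ w 0"
    and "is_perron_data L v lam u \<mu>"
    and "0 < t"
  shows
    "(\<forall>\<nu> c. is_nu_V L v lam \<mu> \<nu> \<and> prob_space (rho_V p0 \<mu> c \<nu>) \<longrightarrow>
        (\<forall>f \<in> Linf P.
           (\<integral>x. ruelle_V L p0 V t f x \<partial>rho_V p0 \<mu> c \<nu>)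
             = exp (t * lam) * (\<integral>x. f x \<partial>rho_V p0 \<mu> c \<nu>)))
     \<and>
     (\<forall>\<nu> c. is_weighted_nu_V L v lam u \<mu> \<nu> \<and> prob_space (rho_V p0 \<mu> c \<nu>) \<longrightarrow>
        (\<forall>f \<in> Linf P \<inter> Linf (rho_V p0 \<mu> c \<nu>).
           (\<integral>x. ruelle_V L p0 V t f x \<partial>rho_V p0 \<mu> c \<nu>)
             = exp (t * lam) * (\<integral>x. f x \<partial>rho_V p0 \<mu> c \<nu>)))"
proof -
  interpret stationary_chain L p0 P by (rule stationary_chain.intro) fact+
  have \<mu>: "0 < \<mu> $ i" for i
    using assms(6) by (simp add: is_perron_data_def positive_probability_vector_def)
  have eigen: "(\<integral>x. ruelle_V L p0 V t f x \<partial>rho_V p0 \<mu> c \<nu>) = exp (t * lam) * (\<integral>x. f x \<partial>rho_V p0 \<mu> c \<nu>)"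
    if \<nu>: "prob_space \<nu>" "sets \<nu> = sets path_algebra"
      and cyl: "\<And>r ts a. time_grid r ts \<Longrightarrow>
        measure \<nu> (cylinder r ts a) = z (a r) * chain_weight (semigroup_V L v lam) \<mu> r ts a"
      and \<rho>: "prob_space (rho_V p0 \<mu> c \<nu>)" and f: "f \<in> Linf (rho_V p0 \<mu> c \<nu>)" for \<nu> c f z
  proof (rule ruelle_V_eigenmeasure[OF assms(7) \<rho> _ _ assms(5) f])
    show "sets (rho_V p0 \<mu> c \<nu>) = sets path_algebra" using \<nu>(2) by (simp add: sets_rho_V)
    have c: "0 < c" by (rule rho_V_normalisation_pos[OF \<rho> p0_pos \<mu>])
    show "measure (rho_V p0 \<mu> c \<nu>) (cylinder r ts a) = z (a r) / c * chain_weight (semigroup_V L v lam) p0 r ts a"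
      if "time_grid r ts" for r ts a
      by (rule measure_rho_V_cylinder[OF \<nu> c p0_pos \<mu> that cyl[OF that]])
  qed
  show ?thesis
  proof (intro conjI allI impI ballI; elim conjE)
    fix \<nu> c f
    assume \<nu>: "is_nu_V L v lam \<mu> \<nu>" and \<rho>: "prob_space (rho_V p0 \<mu> c \<nu>)" and f: "f \<in> Linf P"
    then show "(\<integral>x. ruelle_V L p0 V t f x \<partial>rho_V p0 \<mu> c \<nu>) = exp (t * lam) * (\<integral>x. f x \<partial>rho_V p0 \<mu> c \<nu>)"
      by (intro eigen[where z = "\<lambda>_. 1"] Linf_rho_V_if_is_nu_V[OF assms(1) \<nu> \<mu> \<rho> f])
         (simp_all add: is_nu_V_def)
  next
    fix \<nu> c f
    assume "is_weighted_nu_V L v lam u \<mu> \<nu>" "prob_space (rho_V p0 \<mu> c \<nu>)"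
      and "f \<in> Linf P \<inter> Linf (rho_V p0 \<mu> c \<nu>)"
    then show "(\<integral>x. ruelle_V L p0 V t f x \<partial>rho_V p0 \<mu> c \<nu>) = exp (t * lam) * (\<integral>x. f x \<partial>rho_V p0 \<mu> c \<nu>)"
      by (intro eigen[where z = "\<lambda>i. u $ i"]) (simp_all add: is_weighted_nu_V_def)
  qed
qed

end
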